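(* Let $\mathscr{X}_0$ be a closed subspace of $X^{\odot\star}$. Suppose there exists an interval $J$ such that for every $x^{\odot\star}\in\mathscr{X}_0$ the constant function $J\ni\tau\mapsto x^{\odot\star}$ belongs to $\mathscr{F}_0(J)$, i.e. is an admissible forcing function for $\{T_0(t)\}_{t\ge 0}$ on $J$. Then $\mathscr{X}_0$ is an admissible range for $\{T_0(t)\}_{t\ge0}$.
   Context: All intervals are non-degenerate but otherwise arbitrary. For a Banach space $E$, $\langle x,x^\star\rangle:=x^\star(x)$ for $x\in E$, $x^\star\in E^\star$. Let $\{T_0(t)\}_{t\ge 0}$ be a $\mathcal{C}_0$-semigroup of bounded linear operators on a real or complex Banach space $X$. The sun dual is $X^\odot:=\{x^\star\in X^\star: \lim_{t\downarrow 0}\|T_0(t)^\star x^\star-x^\star\|=0\}$, a norm-closed subspace of $X^\star$ invariant under all $T_0(t)^\star$; $T_0^\odot(t)$ is the restriction of $T_0(t)^\star$ to $X^\odot$ (a $\mathcal{C}_0$-semigroup); $X^{\odot\star}:=(X^\odot)^\star$ and $T_0^{\odot\star}(t):=(T_0^\odot(t))^\star$. The canonical embedding $j:X\to X^{\odot\star}$ is $\langle x^\odot,jx\rangle:=\langle x,x^\odot\rangle$; it is injective with norm-closed range $jX$. It is not assumed that $X$ is sun-reflexive. For an interval $J$ put $\Omega_J:=\{(t,s)\in J\times J: t\ge s\}$. A forcing function on $J$ is a norm-continuous function $f:J\to X^{\odot\star}$, and $v_0(t,s,f):=\int_s^tT_0^{\odot\star}(t-\tau)f(\tau)\,d\tau\in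 X^{\odot\star}$ for $(t,s)\in\Omega_J$, where the integral is the weak$^\star$ integral: $\langle x^\odot,\int_s^tq(\tau)d\tau\rangle:=\int_s^t\langle x^\odot,q(\tau)\rangle d\tau$ for all $x^\odot\in X^\odot$. The forcing function $f$ is an admissible forcing function for $\{T_0(t)\}$ on $J$ if $v_0(t,s,f)\in jX$ for all $(t,s)\in\Omega_J$; the vector space of all of them is $\mathscr{F}_0(J)$. A closed subspace $\mathscr{X}_0$ of $X^{\odot\star}$ is an admissible range for $\{T_0(t)\}$ if, for some (equivalently, for every) interval $J$, every norm-continuous $f:J\to\mathscr{X}_0$ belongs to $\mathscr{F}_0(J)$. *)

theory Defs
  imports "HOL-Analysis.Analysis"
begin

text \<open>
  Scalars: the sort \<open>{real_normed_field, euclidean_space}\<close> stands for the real or the complex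
  field. Both are instances, and as the norm of a \<open>real_normed_field\<close> is multiplicative there are
  no others up to isometric isomorphism (Gelfand--Mazur). A Banach space over \<open>'k\<close> is a
  real Banach space \<open>'a\<close> with a compatible multiplication \<open>scaleK\<close> by scalars in \<open>'k\<close>;
  for \<open>'k = real\<close> this forces \<open>scaleK = scaleR\<close>.
\<close>

locale banach_over = vector_space scaleK
  for scaleK :: "'k::{real_normed_field,euclidean_space} \<Rightarrow> 'a::banach \<Rightarrow> 'a" +
  assumes scaleK_of_real: "scaleK (of_real r) x = r *\<^sub>R x"
    and norm_scaleK: "norm (scaleK c x) = norm c * norm x"

definition C0_semigroup ::
    "('k::{real_normed_field,euclidean_space} \<Rightarrow> 'a::banach \<Rightarrow> 'a) \<Rightarrow> (real \<Rightarrow> 'a \<Rightarrow>\<^sub>L 'a) \<Rightarrow> bool" where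
  "C0_semigroup scaleK T \<longleftrightarrow>
     (\<forall>t\<ge>0. Vector_Spaces.linear scaleK scaleK (blinfun_apply (T t))) \<and>
     T 0 = id_blinfun \<and>
     (\<forall>s\<ge>0. \<forall>t\<ge>0. T (s + t) = T s o\<^sub>L T t) \<and>
     (\<forall>x. ((\<lambda>t. blinfun_apply (T t) x) \<longlongrightarrow> x) (at_right 0))"

text \<open>
  Elements of the dual space are real-linear bounded maps \<open>'a \<Rightarrow>\<^sub>L 'k\<close> that are moreover
  \<open>'k\<close>-linear; the norm inherited from \<open>'a \<Rightarrow>\<^sub>L 'k\<close> is the dual norm. The adjoint
  of \<open>T t\<close> sends \<open>\<phi>\<close> to \<open>\<phi> o\<^sub>L T t\<close>.
\<close>

definition dual_space ::
    "('k::{real_normed_field,euclidean_space} \<Rightarrow> 'a::banach \<Rightarrow> 'a) \<Rightarrow> ('a \<Rightarrow>\<^sub>L 'k) set" where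
  "dual_space scaleK = {\<phi>. Vector_Spaces.linear scaleK (*) (blinfun_apply \<phi>)}"

definition sun_dual ::
    "('k::{real_normed_field,euclidean_space} \<Rightarrow> 'a::banach \<Rightarrow> 'a) \<Rightarrow> (real \<Rightarrow> 'a \<Rightarrow>\<^sub>L 'a)
      \<Rightarrow> ('a \<Rightarrow>\<^sub>L 'k) set" where
  "sun_dual scaleK T =
     {\<phi> \<in> dual_space scaleK. ((\<lambda>t. norm ((\<phi> o\<^sub>L T t) - \<phi>)) \<longlongrightarrow> 0) (at_right 0)}"

text \<open>
  The sun dual depends on the semigroup and hence is a set, not a type. Functionals on it are
  represented by functions that vanish outside it, so that each functional has exactly one
  representative and the vector space operations are the pointwise ones.
\<close>

definition sun_star ::
    "('k::{real_normed_field,euclidean_space} \<Rightarrow> 'a::banach \<Rightarrow> 'a) \<Rightarrow> (real \<Rightarrow> 'a \<Rightarrow>\<^sub>L 'a)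
      \<Rightarrow> (('a \<Rightarrow>\<^sub>L 'k) \<Rightarrow> 'k) set" where
  "sun_star scaleK T =
     {q. (\<forall>\<phi>\<in>sun_dual scaleK T. \<forall>\<psi>\<in>sun_dual scaleK T. q (\<phi> + \<psi>) = q \<phi> + q \<psi>) \<and>
         (\<forall>c. \<forall>\<phi>\<in>sun_dual scaleK T. q (blinfun_mult_right c o\<^sub>L \<phi>) = c * q \<phi>) \<and>
         (\<exists>B. \<forall>\<phi>\<in>sun_dual scaleK T. norm (q \<phi>) \<le> B * norm \<phi>) \<and>
         (\<forall>\<phi>. \<phi> \<notin> sun_dual scaleK T \<longrightarrow> q \<phi> = 0)}"

definition sun_star_norm ::
    "('k::{real_normed_field,euclidean_space} \<Rightarrow> 'a::banach \<Rightarrow> 'a) \<Rightarrow> (real \<Rightarrow> 'a \<Rightarrow>\<^sub>L 'a)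
      \<Rightarrow> (('a \<Rightarrow>\<^sub>L 'k) \<Rightarrow> 'k) \<Rightarrow> real" where
  "sun_star_norm scaleK T q = (SUP \<phi>\<in>sun_dual scaleK T. norm (q \<phi>) / norm \<phi>)"

text \<open>\<^const>\<open>Metric_space\<close> wants symmetry and nonnegativity also off the carrier, where
  the supremum above may be meaningless; hence the case distinction.\<close>

definition sun_star_dist ::
    "('k::{real_normed_field,euclidean_space} \<Rightarrow> 'a::banach \<Rightarrow> 'a) \<Rightarrow> (real \<Rightarrow> 'a \<Rightarrow>\<^sub>L 'a)
      \<Rightarrow> (('a \<Rightarrow>\<^sub>L 'k) \<Rightarrow> 'k) \<Rightarrow> (('a \<Rightarrow>\<^sub>L 'k) \<Rightarrow> 'k) \<Rightarrow> real" where
  "sun_star_dist scaleK T p q =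
     (if p \<in> sun_star scaleK T \<and> q \<in> sun_star scaleK T
      then sun_star_norm scaleK T (\<lambda>\<phi>. p \<phi> - q \<phi>) else 0)"

definition sun_star_topology ::
    "('k::{real_normed_field,euclidean_space} \<Rightarrow> 'a::banach \<Rightarrow> 'a) \<Rightarrow> (real \<Rightarrow> 'a \<Rightarrow>\<^sub>L 'a)
      \<Rightarrow> (('a \<Rightarrow>\<^sub>L 'k) \<Rightarrow> 'k) topology" where
  "sun_star_topology scaleK T = Metric_space.mtopology (sun_star scaleK T) (sun_star_dist scaleK T)"

text \<open>The set \<^term>\<open>S\<close> is contained in \<^term>\<open>sun_star scaleK T\<close>, since \<^const>\<open>closedin\<close> entails
  inclusion in the underlying space of the topology.\<close>

definition closed_subspace ::
    "('k::{real_normed_field,euclidean_space} \<Rightarrow> 'a::banach \<Rightarrow> 'a) \<Rightarrow> (real \<Rightarrow> 'a \<Rightarrow>\<^sub>L 'a)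
      \<Rightarrow> (('a \<Rightarrow>\<^sub>L 'k) \<Rightarrow> 'k) set \<Rightarrow> bool" where
  "closed_subspace scaleK T S \<longleftrightarrow>
     closedin (sun_star_topology scaleK T) S \<and>
     (\<lambda>\<phi>. 0) \<in> S \<and>
     (\<forall>p\<in>S. \<forall>q\<in>S. (\<lambda>\<phi>. p \<phi> + q \<phi>) \<in> S) \<and>
     (\<forall>c. \<forall>q\<in>S. (\<lambda>\<phi>. c * q \<phi>) \<in> S)"

definition sun_star_semigroup ::
    "('k::{real_normed_field,euclidean_space} \<Rightarrow> 'a::banach \<Rightarrow> 'a) \<Rightarrow> (real \<Rightarrow> 'a \<Rightarrow>\<^sub>L 'a)
      \<Rightarrow> real \<Rightarrow> (('a \<Rightarrow>\<^sub>L 'k) \<Rightarrow> 'k) \<Rightarrow> (('a \<Rightarrow>\<^sub>L 'k) \<Rightarrow> 'k)" where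
  "sun_star_semigroup scaleK T t q =
     (\<lambda>\<phi>. if \<phi> \<in> sun_dual scaleK T then q (\<phi> o\<^sub>L T t) else 0)"

definition sun_embed ::
    "('k::{real_normed_field,euclidean_space} \<Rightarrow> 'a::banach \<Rightarrow> 'a) \<Rightarrow> (real \<Rightarrow> 'a \<Rightarrow>\<^sub>L 'a)
      \<Rightarrow> 'a \<Rightarrow> (('a \<Rightarrow>\<^sub>L 'k) \<Rightarrow> 'k)" where
  "sun_embed scaleK T x = (\<lambda>\<phi>. if \<phi> \<in> sun_dual scaleK T then blinfun_apply \<phi> x else 0)"

definition weak_star_integral ::
    "('k::{real_normed_field,euclidean_space} \<Rightarrow> 'a::banach \<Rightarrow> 'a) \<Rightarrow> (real \<Rightarrow> 'a \<Rightarrow>\<^sub>L 'a)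
      \<Rightarrow> real \<Rightarrow> real \<Rightarrow> (real \<Rightarrow> (('a \<Rightarrow>\<^sub>L 'k) \<Rightarrow> 'k)) \<Rightarrow> (('a \<Rightarrow>\<^sub>L 'k) \<Rightarrow> 'k)" where
  "weak_star_integral scaleK T s t q =
     (\<lambda>\<phi>. if \<phi> \<in> sun_dual scaleK T then integral {s..t} (\<lambda>\<tau>. q \<tau> \<phi>) else 0)"

definition v0 ::
    "('k::{real_normed_field,euclidean_space} \<Rightarrow> 'a::banach \<Rightarrow> 'a) \<Rightarrow> (real \<Rightarrow> 'a \<Rightarrow>\<^sub>L 'a)
      \<Rightarrow> real \<Rightarrow> real \<Rightarrow> (real \<Rightarrow> (('a \<Rightarrow>\<^sub>L 'k) \<Rightarrow> 'k)) \<Rightarrow> (('a \<Rightarrow>\<^sub>L 'k) \<Rightarrow> 'k)" where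
  "v0 scaleK T t s f =
     weak_star_integral scaleK T s t (\<lambda>\<tau>. sun_star_semigroup scaleK T (t - \<tau>) (f \<tau>))"

definition nondegenerate_interval :: "real set \<Rightarrow> bool" where
  "nondegenerate_interval J \<longleftrightarrow> is_interval J \<and> (\<exists>a\<in>J. \<exists>b\<in>J. a < b)"

text \<open>Only the values of \<^term>\<open>f\<close> on \<^term>\<open>J\<close> matter below.\<close>

definition admissible_forcing ::
    "('k::{real_normed_field,euclidean_space} \<Rightarrow> 'a::banach \<Rightarrow> 'a) \<Rightarrow> (real \<Rightarrow> 'a \<Rightarrow>\<^sub>L 'a)
      \<Rightarrow> real set \<Rightarrow> (real \<Rightarrow> (('a \<Rightarrow>\<^sub>L 'k) \<Rightarrow> 'k)) set" where
  "admissible_forcing scaleK T J =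
     {f. continuous_map (top_of_set J) (sun_star_topology scaleK T) f \<and>
         (\<forall>t\<in>J. \<forall>s\<in>J. s \<le> t \<longrightarrow> v0 scaleK T t s f \<in> range (sun_embed scaleK T))}"

text \<open>The requirement on \<^term>\<open>J\<close> does not depend on the choice of the interval; of the two
  equivalent readings (some interval, every interval) the formally stronger one is taken.\<close>

definition admissible_range ::
    "('k::{real_normed_field,euclidean_space} \<Rightarrow> 'a::banach \<Rightarrow> 'a) \<Rightarrow> (real \<Rightarrow> 'a \<Rightarrow>\<^sub>L 'a)
      \<Rightarrow> (('a \<Rightarrow>\<^sub>L 'k) \<Rightarrow> 'k) set \<Rightarrow> bool" where
  "admissible_range scaleK T S \<longleftrightarrow>
     closed_subspace scaleK T S \<and>
     (\<forall>J. nondegenerate_interval J \<longrightarrow>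
        (\<forall>f. continuous_map (top_of_set J) (sun_star_topology scaleK T) f \<and> f ` J \<subseteq> S
             \<longrightarrow> f \<in> admissible_forcing scaleK T J))"

lemma banach_over_real: "banach_over ((*\<^sub>R) :: real \<Rightarrow> 'a::banach \<Rightarrow> 'a)"
  by unfold_locales (simp_all add: scaleR_right_distrib scaleR_left_distrib)

lemma banach_over_complex: "banach_over ((*) :: complex \<Rightarrow> complex \<Rightarrow> complex)"
  by unfold_locales (simp_all add: distrib_left distrib_right norm_mult scaleR_conv_of_real)

lemma zero_in_sun_dual:
  assumes "banach_over scaleK"
  shows "0 \<in> sun_dual scaleK T"
proof -
  interpret banach_over scaleK by fact
  have "vector_space_pair scaleK ((*) :: 'a \<Rightarrow> 'a \<Rightarrow> 'a)"
    by unfold_locales (simp_all add: distrib_left distrib_right)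
  then have "Vector_Spaces.linear scaleK ((*) :: 'a \<Rightarrow> 'a \<Rightarrow> 'a) (\<lambda>x. 0)"
    by (rule vector_space_pair.linear_zero)
  moreover have "blinfun_apply (0 :: 'b \<Rightarrow>\<^sub>L 'a) = (\<lambda>x. 0)"
    by (simp add: fun_eq_iff)
  moreover have "(0 :: 'b \<Rightarrow>\<^sub>L 'a) o\<^sub>L T t = 0" for t
    by (rule blinfun_eqI) simp
  ultimately show ?thesis
    by (simp add: sun_dual_def dual_space_def)
qed

lemma Metric_space_sun_star:
  assumes "banach_over scaleK"
  shows "Metric_space (sun_star scaleK T) (sun_star_dist scaleK T)"
proof -
  let ?D = "sun_dual scaleK T" and ?S = "sun_star scaleK T"
  have ne: "0 \<in> ?D"
    by (rule zero_in_sun_dual[OF assms])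
  have bdd: "bdd_above ((\<lambda>\<phi>. norm (p \<phi> - q \<phi>) / norm \<phi>) ` ?D)" if pq: "p \<in> ?S" "q \<in> ?S" for p q
  proof -
    obtain A B where A: "\<forall>\<phi>\<in>?D. norm (p \<phi>) \<le> A * norm \<phi>" and B: "\<forall>\<phi>\<in>?D. norm (q \<phi>) \<le> B * norm \<phi>"
      using pq unfolding sun_star_def by auto
    have "norm (p \<phi> - q \<phi>) / norm \<phi> \<le> max 0 (A + B)" if "\<phi> \<in> ?D" for \<phi>
    proof (cases "\<phi> = 0")
      case False
      have "norm (p \<phi> - q \<phi>) \<le> A * norm \<phi> + B * norm \<phi>"
        using A B that norm_triangle_ineq4[of "p \<phi>" "q \<phi>"] by force
      then have "norm (p \<phi> - q \<phi>) / norm \<phi> \<le> A + B"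
        using False by (simp add: field_simps)
      then show ?thesis by simp
    qed simp
    then show ?thesis by (auto intro!: bdd_aboveI)
  qed
  have upper: "norm (p \<phi> - q \<phi>) / norm \<phi> \<le> sun_star_dist scaleK T p q"
    if "p \<in> ?S" "q \<in> ?S" "\<phi> \<in> ?D" for p q \<phi>
    using cSUP_upper[OF that(3) bdd[OF that(1,2)]] that
    by (simp add: sun_star_dist_def sun_star_norm_def)
  have least: "sun_star_dist scaleK T p q \<le> b"
    if "p \<in> ?S" "q \<in> ?S" "\<And>\<phi>. \<phi> \<in> ?D \<Longrightarrow> norm (p \<phi> - q \<phi>) / norm \<phi> \<le> b" for p q b
    using that ne by (auto simp: sun_star_dist_def sun_star_norm_def intro!: cSUP_least)
  have zero_val: "p 0 = 0" if "p \<in> ?S" for p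
    using that ne unfolding sun_star_def by fastforce
  show ?thesis
  proof
    show "0 \<le> sun_star_dist scaleK T p q" for p q
      using upper[of p q 0] ne by (cases "p \<in> ?S \<and> q \<in> ?S") (auto simp: sun_star_dist_def)
    show "sun_star_dist scaleK T p q = sun_star_dist scaleK T q p" for p q
      by (simp add: sun_star_dist_def sun_star_norm_def norm_minus_commute)
    show "sun_star_dist scaleK T p q = 0 \<longleftrightarrow> p = q" if pq: "p \<in> ?S" "q \<in> ?S" for p q
    proof
      assume 0: "sun_star_dist scaleK T p q = 0"
      show "p = q"
      proof
        fix \<phi>
        show "p \<phi> = q \<phi>"
        proof (cases "\<phi> \<in> ?D \<and> \<phi> \<noteq> 0")
          case True
          then show ?thesis
            using upper[OF pq, of \<phi>] 0 by (simp add: divide_le_0_iff)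
        next
          case False
          then show ?thesis
            using pq zero_val[OF pq(1)] zero_val[OF pq(2)] by (auto simp: sun_star_def)
        qed
      qed
    next
      assume "p = q"
      then show "sun_star_dist scaleK T p q = 0"
      proof (intro order_antisym)
        show "sun_star_dist scaleK T p q \<le> 0"
          by (rule least[OF pq]) (simp add: \<open>p = q\<close>)
        show "0 \<le> sun_star_dist scaleK T p q"
          using upper[OF pq ne] by simp
      qed
    qed
    show "sun_star_dist scaleK T p r \<le> sun_star_dist scaleK T p q + sun_star_dist scaleK T q r"
      if "p \<in> ?S" "q \<in> ?S" "r \<in> ?S" for p q r
    proof (rule least[OF that(1,3)])
      fix \<phi> assume "\<phi> \<in> ?D"
      have "norm (p \<phi> - r \<phi>) / norm \<phi> \<le> norm (p \<phi> - q \<phi>) / norm \<phi> + norm (q \<phi> - r \<phi>) / norm \<phi>"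
        using norm_triangle_ineq[of "p \<phi> - q \<phi>" "q \<phi> - r \<phi>"]
        by (simp add: add_divide_distrib[symmetric] divide_right_mono)
      also have "\<dots> \<le> sun_star_dist scaleK T p q + sun_star_dist scaleK T q r"
        by (intro add_mono upper that \<open>\<phi> \<in> ?D\<close>)
      finally show "norm (p \<phi> - r \<phi>) / norm \<phi> \<le> sun_star_dist scaleK T p q + sun_star_dist scaleK T q r" .
    qed
  qed
qed

end

theory Submission
  imports Defs
begin

text \<open>
  Let \<open>F\<close> be the weak-star convolution of the semigroup with a continuous \<open>f\<close> taking values in the
  given subspace. If \<open>f\<close> is constant on a short interval, then the corresponding piece of \<open>F\<close> lies in
  \<open>jX\<close>: by translation this is the assumption when the piece ends at the final time, and otherwise
  one more application of the semigroup is needed, which maps \<open>jX\<close> into itself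
  (\<open>short_constant_convolution\<close>). As \<open>f\<close> is continuous, it is locally within \<open>\<epsilon>\<close> of a constant, and
  the local errors add up to at most a multiple of \<open>\<epsilon>\<close> times the length of the interval
  (\<open>convolution_approx\<close>; the bisection principle \<open>Bolzano\<close> replaces a partition into short
  intervals). Hence \<open>F\<close> is a norm limit of elements of \<open>jX\<close>, and it remains to know that \<open>jX\<close> is norm
  closed (\<open>functional_approximable_imp_embedded\<close>).

  Closedness of \<open>jX\<close> means that \<open>\<parallel>x\<parallel> \<le> M \<parallel>jx\<parallel>\<close> for some \<open>M\<close>, i.e. that the sun dual is norming up
  to a constant (\<open>sun_norming\<close>). The full dual is norming by the Hahn--Banach theorem, and every
  functional \<open>\<phi>\<close> is the weak-star limit, as \<open>h\<close> tends to \<open>0\<close>, of the means of its orbit under the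
  adjoint semigroup over \<open>[0, h]\<close>. These means belong to the sun dual, and their norms are at most
  \<open>M \<parallel>\<phi>\<parallel>\<close> if \<open>M\<close> bounds the semigroup on \<open>[0, 1]\<close>; such an \<open>M\<close> comes from the uniform boundedness
  principle.

  Everything takes place over an abstract finite-dimensional normed field. The Hahn--Banach theorem
  is proved over the reals and then transferred: every real-linear functional on the field has
  exactly one representation \<open>c \<mapsto> (c * d) \<bullet> 1\<close>, which turns a real-linear functional on the space into
  one that is linear over the field.
\<close>

section \<open>The Hahn--Banach theorem\<close>

definition sublinear :: "('a::real_vector \<Rightarrow> real) \<Rightarrow> bool" where
  "sublinear p \<longleftrightarrow> (\<forall>x y. p (x + y) \<le> p x + p y) \<and> (\<forall>c\<ge>0. \<forall>x. p (c *\<^sub>R x) = c * p x)"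

lemma sublinear_add: "sublinear p \<Longrightarrow> p (x + y) \<le> p x + p y"
  and sublinear_scale: "sublinear p \<Longrightarrow> c \<ge> 0 \<Longrightarrow> p (c *\<^sub>R x) = c * p x"
  by (auto simp: sublinear_def)

lemma sublinear_0: "sublinear p \<Longrightarrow> p 0 = 0"
  using sublinear_scale[of p 0 0] by simp

lemma sublinear_minus: "sublinear p \<Longrightarrow> - p (- x) \<le> p x"
  using sublinear_add[of p x "- x"] sublinear_0[of p] by simp

lemma sublinearI:
  assumes add: "\<And>x y. p (x + y) \<le> p x + p y" and 0: "p 0 = 0"
    and scale: "\<And>c x. c > 0 \<Longrightarrow> p (c *\<^sub>R x) \<le> c * p x"
  shows "sublinear p"
  unfolding sublinear_def
proof (intro conjI allI impI add)
  fix c :: real and x assume "c \<ge> 0"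
  show "p (c *\<^sub>R x) = c * p x"
  proof (cases "c = 0")
    case False
    with \<open>c \<ge> 0\<close> have "c > 0" by simp
    have "p x \<le> inverse c * p (c *\<^sub>R x)"
      using scale[of "inverse c" "c *\<^sub>R x"] \<open>c > 0\<close> by simp
    then have "c * p x \<le> p (c *\<^sub>R x)"
      using \<open>c > 0\<close> by (simp add: field_simps)
    then show ?thesis using scale[OF \<open>c > 0\<close>, of x] by simp
  qed (simp add: 0)
qed

text \<open>The Hahn--Banach theorem is obtained from minimal sublinear functionals. The functional
  \<open>directional_inf p y\<close> is sublinear, lies below \<open>p\<close>, and takes a value of at most \<open>- p y\<close> at \<open>- y\<close>.
  It serves two purposes: a minimal \<open>p\<close> must coincide with it for every \<open>y\<close>, which makes \<open>p\<close>
  additive; and replacing a majorant \<open>p\<close> by it forces every linear functional below it to attain the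
  value \<open>p y\<close> at \<open>y\<close>.\<close>

definition directional_inf :: "('a::real_vector \<Rightarrow> real) \<Rightarrow> 'a \<Rightarrow> 'a \<Rightarrow> real" where
  "directional_inf p y x = (INF t\<in>{0..}. p (x + t *\<^sub>R y) - t * p y)"

context
  fixes p :: "'a::real_vector \<Rightarrow> real"
  assumes p: "sublinear p"
begin

lemma directional_inf_lower:
  assumes "t \<ge> 0"
  shows "directional_inf p y x \<le> p (x + t *\<^sub>R y) - t * p y"
proof -
  have "- p (- x) \<le> p (x + r *\<^sub>R y) - r * p y" if "r \<ge> 0" for r
    using sublinear_add[OF p, of "x + r *\<^sub>R y" "- x"] sublinear_scale[OF p that, of y] by simp
  then have "bdd_below ((\<lambda>t. p (x + t *\<^sub>R y) - t * p y) ` {0..})"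
    by (auto intro!: bdd_belowI2)
  then show ?thesis
    unfolding directional_inf_def using assms by (intro cINF_lower) auto
qed

lemma directional_inf_greatest:
  assumes "\<And>t. t \<ge> 0 \<Longrightarrow> b \<le> p (x + t *\<^sub>R y) - t * p y"
  shows "b \<le> directional_inf p y x"
  unfolding directional_inf_def using assms by (intro cINF_greatest) auto

lemma directional_inf_le: "directional_inf p y x \<le> p x"
  using directional_inf_lower[of 0 y x] by simp

lemma directional_inf_minus: "directional_inf p y (- y) \<le> - p y"
  using directional_inf_lower[of 1 y "- y"] sublinear_0[OF p] by simp

lemma sublinear_directional_inf: "sublinear (directional_inf p y)"
proof (rule sublinearI)
  fix u v
  have *: "directional_inf p y (u + v) - (p (v + r *\<^sub>R y) - r * p y) \<le> p (u + t *\<^sub>R y) - t * p y"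
    if "t \<ge> 0" "r \<ge> 0" for t r
  proof -
    have "directional_inf p y (u + v) \<le> p ((u + v) + (t + r) *\<^sub>R y) - (t + r) * p y"
      using that by (intro directional_inf_lower) simp
    also have "(u + v) + (t + r) *\<^sub>R y = (u + t *\<^sub>R y) + (v + r *\<^sub>R y)"
      by (simp add: scaleR_add_left)
    finally show ?thesis
      using sublinear_add[OF p, of "u + t *\<^sub>R y" "v + r *\<^sub>R y"] by (simp add: algebra_simps)
  qed
  have "directional_inf p y (u + v) - (p (v + r *\<^sub>R y) - r * p y) \<le> directional_inf p y u" if "r \<ge> 0" for r
    using *[OF _ that] by (intro directional_inf_greatest)
  then have "directional_inf p y (u + v) - directional_inf p y u \<le> directional_inf p y v"
    by (intro directional_inf_greatest) (simp add: algebra_simps)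
  then show "directional_inf p y (u + v) \<le> directional_inf p y u + directional_inf p y v" by simp
next
  have "0 \<le> directional_inf p y 0"
    by (rule directional_inf_greatest) (simp add: sublinear_scale[OF p])
  then show "directional_inf p y 0 = 0"
    using directional_inf_le[of y 0] sublinear_0[OF p] by simp
next
  fix c :: real and x assume "c > 0"
  have "directional_inf p y (c *\<^sub>R x) / c \<le> p (x + t *\<^sub>R y) - t * p y" if "t \<ge> 0" for t
  proof -
    have "directional_inf p y (c *\<^sub>R x) \<le> p (c *\<^sub>R (x + t *\<^sub>R y)) - (c * t) * p y"
      using directional_inf_lower[of "c * t" y "c *\<^sub>R x"] \<open>c > 0\<close> that by (simp add: scaleR_add_right)
    also have "\<dots> = c * (p (x + t *\<^sub>R y) - t * p y)"
      using \<open>c > 0\<close> sublinear_scale[OF p, of c "x + t *\<^sub>R y"] by (simp add: algebra_simps)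
    finally show ?thesis using \<open>c > 0\<close> by (simp add: field_simps)
  qed
  then have "directional_inf p y (c *\<^sub>R x) / c \<le> directional_inf p y x"
    by (rule directional_inf_greatest)
  then show "directional_inf p y (c *\<^sub>R x) \<le> c * directional_inf p y x"
    using \<open>c > 0\<close> by (simp add: field_simps)
qed

end

text \<open>The pointwise infimum of a chain works. It is finite because \<open>- N (- x) \<le> p x\<close> for every sublinear
  \<open>p \<le> N\<close>, and subadditive because any two members of a chain can be replaced by the smaller one.\<close>

lemma sublinear_chain_lower_bound:
  fixes N :: "'a::real_vector \<Rightarrow> real"
  assumes sub: "\<And>p. p \<in> C \<Longrightarrow> sublinear p \<and> p \<le> N" and "C \<noteq> {}"
    and chain: "\<And>p q. p \<in> C \<Longrightarrow> q \<in> C \<Longrightarrow> p \<le> q \<or> q \<le> p"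
  shows "\<exists>m. sublinear m \<and> (\<forall>p\<in>C. m \<le> p)"
proof (intro exI conjI ballI)
  define m where "m x = (INF p\<in>C. p x)" for x
  have bdd: "bdd_below ((\<lambda>p. p x) ` C)" for x
  proof (rule bdd_belowI2)
    fix p assume "p \<in> C"
    then have "- N (- x) \<le> - p (- x)"
      using sub[of p] by (simp add: le_fun_def)
    also have "\<dots> \<le> p x"
      using sub \<open>p \<in> C\<close> by (blast intro: sublinear_minus)
    finally show "- N (- x) \<le> p x" .
  qed
  have lower: "m x \<le> p x" if "p \<in> C" for p x
    unfolding m_def using that by (intro cINF_lower bdd)
  have greatest: "b \<le> m x" if "\<And>p. p \<in> C \<Longrightarrow> b \<le> p x" for b x
    unfolding m_def using that \<open>C \<noteq> {}\<close> by (intro cINF_greatest)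
  show "m \<le> p" if "p \<in> C" for p
    using lower[OF that] by (simp add: le_fun_def)
  show "sublinear m"
  proof (rule sublinearI)
    fix x y
    have *: "m (x + y) \<le> p x + q y" if pq: "p \<in> C" "q \<in> C" for p q
    proof -
      obtain r where r: "r \<in> C" "r \<le> p" "r \<le> q"
        using chain[OF pq] pq by blast
      have "m (x + y) \<le> r x + r y"
        using lower[OF r(1)] sublinear_add[of r x y] sub[OF r(1)] by (meson order_trans)
      also have "\<dots> \<le> p x + q y"
        using r by (intro add_mono) (auto simp: le_fun_def)
      finally show ?thesis .
    qed
    have "m (x + y) - q y \<le> m x" if "q \<in> C" for q
      using *[OF _ that] by (intro greatest) (simp add: algebra_simps)
    then have "m (x + y) - m x \<le> m y"
      by (intro greatest) (simp add: algebra_simps)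
    then show "m (x + y) \<le> m x + m y" by simp
  next
    show "m 0 = 0"
      using sub \<open>C \<noteq> {}\<close> by (simp add: m_def sublinear_0 cong: INF_cong)
  next
    fix c :: real and x assume "c > 0"
    have "m (c *\<^sub>R x) / c \<le> p x" if "p \<in> C" for p
      using lower[OF that, of "c *\<^sub>R x"] sub[OF that] sublinear_scale[of p c x] \<open>c > 0\<close>
      by (simp add: field_simps)
    then have "m (c *\<^sub>R x) / c \<le> m x" by (rule greatest)
    then show "m (c *\<^sub>R x) \<le> c * m x"
      using \<open>c > 0\<close> by (simp add: field_simps)
  qed
qed

theorem hahn_banach_sublinear:
  fixes N :: "'a::real_vector \<Rightarrow> real"
  assumes N: "sublinear N"
  shows "\<exists>f. linear f \<and> (\<forall>x. f x \<le> N x)"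
proof -
  define A where "A = {p. sublinear p \<and> p \<le> N}"
  have "\<exists>m\<in>A. \<forall>p\<in>A. p \<le> m \<longrightarrow> p = m"
  proof (rule predicate_Zorn)
    show "partial_order_on A (relation_of (\<lambda>p q. q \<le> p) A)"
      by (auto simp: partial_order_on_def preorder_on_def refl_on_def trans_def antisym_def
          relation_of_def)
    fix C assume C: "C \<in> Chains (relation_of (\<lambda>p q. q \<le> p) A)"
    show "\<exists>u\<in>A. \<forall>p\<in>C. u \<le> p"
    proof (cases "C = {}")
      case True
      then show ?thesis using N by (auto simp: A_def)
    next
      case False
      have "C \<subseteq> A" using C by (rule Chains_relation_of)
      then have sub: "sublinear p \<and> p \<le> N" if "p \<in> C" for p
        using that by (auto simp: A_def)
      have chain: "p \<le> q \<or> q \<le> p" if "p \<in> C" "q \<in> C" for p q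
        using C that by (auto simp: Chains_def relation_of_def)
      obtain m where m: "sublinear m" "\<And>p. p \<in> C \<Longrightarrow> m \<le> p"
        using sublinear_chain_lower_bound[OF sub False chain] by blast
      have "m \<le> N"
        using False m(2) sub by (meson order_trans ex_in_conv)
      then show ?thesis using m by (auto simp: A_def)
    qed
  qed
  then obtain f where f: "sublinear f" "f \<le> N" and min: "\<And>p. p \<in> A \<Longrightarrow> p \<le> f \<Longrightarrow> p = f"
    by (auto simp: A_def)
  \<comment> \<open>Minimality: \<open>directional_inf f y\<close> competes with \<open>f\<close>.\<close>
  have dir: "directional_inf f y = f" for y
  proof (rule min)
    show le: "directional_inf f y \<le> f"
      using directional_inf_le[OF f(1)] by (simp add: le_fun_def)
    show "directional_inf f y \<in> A"
      using sublinear_directional_inf[OF f(1)] le f(2) by (auto simp: A_def)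
  qed
  have add: "f (x + y) = f x + f y" for x y
    using directional_inf_lower[OF f(1), of 1 y x] sublinear_add[OF f(1), of x y] by (simp add: dir)
  have minus: "f (- x) = - f x" for x
    using add[of x "- x"] sublinear_0[OF f(1)] by simp
  have "linear f"
  proof (rule linearI[OF add])
    fix c :: real and x
    show "f (c *\<^sub>R x) = c *\<^sub>R f x"
    proof (cases "c \<ge> 0")
      case False
      then have "f (- (c *\<^sub>R x)) = - c * f x"
        using sublinear_scale[OF f(1), of "- c" x] by simp
      then show ?thesis using minus[of "c *\<^sub>R x"] by simp
    qed (simp add: sublinear_scale[OF f(1)])
  qed
  then show ?thesis using f(2) by (auto simp: le_fun_def)
qed

corollary hahn_banach_norming:
  fixes x :: "'a::real_normed_vector"
  shows "\<exists>f :: 'a \<Rightarrow> real. linear f \<and> (\<forall>y. \<bar>f y\<bar> \<le> norm y) \<and> f x = norm x"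
proof -
  have norm: "sublinear (norm :: 'a \<Rightarrow> real)"
    by (simp add: sublinear_def norm_triangle_ineq)
  obtain f where f: "linear f" "\<And>y. f y \<le> directional_inf norm x y"
    using hahn_banach_sublinear[OF sublinear_directional_inf[OF norm, of x]] by blast
  have le: "f y \<le> norm y" for y
    using f(2) directional_inf_le[OF norm] order_trans by blast
  have neg: "f (- y) = - f y" for y
    using f(1) by (rule linear_neg)
  have "norm x \<le> f x"
    using f(2)[of "- x"] directional_inf_minus[OF norm, of x] neg[of x] by linarith
  moreover have "\<bar>f y\<bar> \<le> norm y" for y
    using le[of y] le[of "- y"] neg[of y] by simp
  ultimately show ?thesis
    using f(1) le[of x] by (intro exI[of _ f]) auto
qed

text \<open>The bilinear form \<open>(c, d) \<mapsto> (c * d) \<bullet> 1\<close> is nondegenerate, since \<open>d \<noteq> 0\<close> is paired with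
  \<open>inverse d\<close> to \<open>1 \<bullet> 1\<close>. In finite dimension it therefore represents every functional. For the complex field
  the form is the real part of the product.\<close>

lemma field_functional_representation:
  fixes g :: "'k::{real_normed_field,euclidean_space} \<Rightarrow> real"
  assumes "linear g"
  shows "\<exists>!d. \<forall>c. g c = (c * d) \<bullet> 1"
proof -
  \<comment> \<open>\<open>A d\<close> is the vector that represents \<open>c \<mapsto> (c * d) \<bullet> 1\<close> with respect to the inner product.\<close>
  define A :: "'k \<Rightarrow> 'k" where "A d = (\<Sum>b\<in>Basis. ((b * d) \<bullet> 1) *\<^sub>R b)" for d
  have A: "c \<bullet> A d = (c * d) \<bullet> 1" for c d
  proof -
    have "(c * d) \<bullet> 1 = ((\<Sum>b\<in>Basis. (c \<bullet> b) *\<^sub>R b) * d) \<bullet> 1"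
      by (simp add: euclidean_representation)
    also have "\<dots> = (\<Sum>b\<in>Basis. (c \<bullet> b) * ((b * d) \<bullet> 1))"
      by (simp add: sum_distrib_right inner_sum_left)
    also have "\<dots> = c \<bullet> A d"
      by (simp add: A_def inner_sum_right mult.commute)
    finally show ?thesis by simp
  qed
  have lin: "linear A"
    by (rule linearI)
       (auto simp: A_def distrib_left inner_add_left scaleR_add_left sum.distrib
          scaleR_sum_right)
  have "d = 0" if "A d = 0" for d
  proof (rule ccontr)
    assume "d \<noteq> 0"
    then show False using A[of "inverse d" d] that by simp
  qed
  then have inj: "inj A"
    by (simp add: linear_injective_0[OF lin])
  have "surj A"
    using lin inj by (rule linear_injective_imp_surjective) simp
  then obtain d where Ad: "A d = (\<Sum>b\<in>Basis. g b *\<^sub>R b)"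
    by (metis surjD)
  have "g c = c \<bullet> (\<Sum>b\<in>Basis. g b *\<^sub>R b)" for c
  proof -
    have "g c = g (\<Sum>b\<in>Basis. (c \<bullet> b) *\<^sub>R b)"
      by (simp add: euclidean_representation)
    also have "\<dots> = (\<Sum>b\<in>Basis. (c \<bullet> b) * g b)"
      by (simp add: linear_sum[OF assms] linear_cmul[OF assms])
    finally show ?thesis
      by (simp add: inner_sum_right mult.commute)
  qed
  then have d: "g c = (c * d) \<bullet> 1" for c
    unfolding A[symmetric] Ad .
  have "d' = d" if "\<forall>c. g c = (c * d') \<bullet> 1" for d'
  proof -
    have "c \<bullet> A d' = c \<bullet> A d" for c
      using d that by (simp add: A)
    then have "A d' = A d"
      using vector_eq_ldot by blast
    then show ?thesis using inj by (simp add: inj_eq)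
  qed
  with d show ?thesis by blast
qed

text \<open>A norming real functional \<open>f\<close> is the image, under \<open>c \<mapsto> c \<bullet> 1\<close>, of a functional \<open>F\<close> that is linear
  over the field: \<open>F y\<close> represents \<open>c \<mapsto> f (scaleK c y)\<close>, and the uniqueness of the representation
  gives linearity. For the complex field this is the usual \<open>F y = f y - \<i> f (\<i> y)\<close>.\<close>

lemma (in banach_over) dual_norming:
  obtains \<phi> where "\<phi> \<in> dual_space scaleK" "norm \<phi> \<le> 1" "norm x \<le> norm (blinfun_apply \<phi> x)"
proof -
  obtain f :: "'a \<Rightarrow> real" where f: "linear f" "\<And>y. \<bar>f y\<bar> \<le> norm y" "f x = norm x"
    using hahn_banach_norming by blast
  have scaleK_scaleR: "scaleK (r *\<^sub>R c) y = r *\<^sub>R scaleK c y" for r c y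
    by (metis scaleK_of_real scale_scale scaleR_conv_of_real)
  have "linear (\<lambda>c. f (scaleK c y))" for y
    by (rule linearI)
       (simp_all add: scale_left_distrib scaleK_scaleR linear_add[OF f(1)] linear_cmul[OF f(1)])
  then have ex1: "\<exists>!d. \<forall>c. f (scaleK c y) = (c * d) \<bullet> 1" for y
    by (rule field_functional_representation)
  define F where "F y = (THE d. \<forall>c. f (scaleK c y) = (c * d) \<bullet> 1)" for y
  have F: "f (scaleK c y) = (c * F y) \<bullet> 1" for c y
  proof -
    have "\<forall>c. f (scaleK c y) = (c * F y) \<bullet> 1"
      unfolding F_def by (rule theI'[OF ex1])
    then show ?thesis ..
  qed
  have F_unique: "F y = d" if "\<And>c. f (scaleK c y) = (c * d) \<bullet> 1" for d y
    unfolding F_def using that by (intro the1_equality[OF ex1]) blast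
  have add: "F (y + z) = F y + F z" for y z
    by (rule F_unique)
       (simp add: scale_right_distrib linear_add[OF f(1)] F distrib_left inner_add_left)
  have scale: "F (scaleK c y) = c * F y" for c y
    by (rule F_unique) (simp add: F mult.assoc)
  have bound: "norm (F y) \<le> norm y" for y
  proof (cases "F y = 0")
    case False
    \<comment> \<open>Scaling \<open>y\<close> by \<open>inverse (F y)\<close> normalises the value of \<open>F\<close> to \<open>1\<close>, so that the bound on \<open>f\<close> bounds \<open>F y\<close>.\<close>
    have "(1::'k) \<bullet> 1 = f (scaleK (inverse (F y)) y)"
      using False by (simp add: F)
    also have "\<dots> \<le> norm (scaleK (inverse (F y)) y)"
      using f(2) abs_le_D1 by blast
    also have "\<dots> = norm y / norm (F y)"
      by (simp add: norm_scaleK norm_inverse divide_inverse)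
    finally have "1 \<le> norm y / norm (F y)"
      by (simp add: dot_square_norm)
    then show ?thesis using False by (simp add: field_simps)
  qed simp
  have scaleR: "F (r *\<^sub>R y) = r *\<^sub>R F y" for r y
    using scale[of "of_real r" y] by (simp add: scaleK_of_real scaleR_conv_of_real)
  have bl: "bounded_linear F"
    by (rule bounded_linear_intro[where K = 1]) (simp_all add: add scaleR bound)
  show thesis
  proof
    show "Blinfun F \<in> dual_space scaleK"
      unfolding dual_space_def mem_Collect_eq bounded_linear_Blinfun_apply[OF bl]
      by unfold_locales (simp_all add: add scale distrib_left distrib_right)
    show "norm (Blinfun F) \<le> 1"
      by (rule norm_blinfun_bound) (simp_all add: bounded_linear_Blinfun_apply[OF bl] bound)
    have "norm x = F x \<bullet> 1"
      using F[of 1 x] f(3) by simp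
    also have "\<dots> \<le> norm (F x)"
      using norm_cauchy_schwarz[of "F x" 1] by simp
    finally show "norm x \<le> norm (blinfun_apply (Blinfun F) x)"
      by (simp add: bounded_linear_Blinfun_apply[OF bl])
  qed
qed

section \<open>The uniform boundedness principle\<close>

text \<open>The sets \<open>F n\<close> of points at which the whole family is bounded by \<open>n\<close> are closed and cover the space,
  so that by Baire's theorem one of them contains a ball; differences of points of this ball cover
  a ball about the origin.\<close>

theorem uniform_boundedness:
  fixes T :: "'i \<Rightarrow> 'a::banach \<Rightarrow>\<^sub>L 'b::real_normed_vector"
  assumes pw: "\<And>x. bounded ((\<lambda>i. blinfun_apply (T i) x) ` I)"
  obtains M where "\<And>i. i \<in> I \<Longrightarrow> norm (T i) \<le> M"
proof -
  define F where "F n = {x. \<forall>i\<in>I. norm (blinfun_apply (T i) x) \<le> real n}" for n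
  have closed: "closed (F n)" for n
  proof -
    have "F n = (\<Inter>i\<in>I. {x. norm (blinfun_apply (T i) x) \<le> real n})"
      by (auto simp: F_def)
    then show ?thesis
      by (auto intro!: closed_INT closed_Collect_le continuous_intros)
  qed
  have "\<exists>n. interior (F n) \<noteq> {}"
  proof (rule ccontr)
    assume *: "\<not> ?thesis"
    have "euclidean interior_of \<Union>(range F) = {}"
      using * closed
      by (intro Baire_category_alt)
         (auto simp: completely_metrizable_space_euclidean interior_of_eq_empty)
    moreover have "\<Union>(range F) = UNIV"
    proof -
      have "\<exists>n. x \<in> F n" for x
      proof -
        obtain B where "\<forall>i\<in>I. norm (blinfun_apply (T i) x) \<le> B"
          using pw[of x] by (auto simp: bounded_iff)
        moreover obtain n where "B \<le> real n" using real_arch_simple by blast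
        ultimately have "x \<in> F n" unfolding F_def by (blast intro: order_trans)
        then show ?thesis ..
      qed
      then show ?thesis by auto
    qed
    ultimately show False by simp
  qed
  then obtain n z where "z \<in> interior (F n)" by blast
  then obtain r where r: "r > 0" "cball z r \<subseteq> F n"
    by (auto simp: mem_interior_cball)
  show thesis
  proof
    fix i assume i: "i \<in> I"
    have small: "norm (blinfun_apply (T i) y) \<le> 2 * real n" if "norm y \<le> r" for y
    proof -
      have "z \<in> F n" "z + y \<in> F n"
        using r that by (auto simp: dist_norm)
      then have "norm (blinfun_apply (T i) z) \<le> n" "norm (blinfun_apply (T i) (z + y)) \<le> n"
        using i by (auto simp: F_def)
      then show ?thesis
        using norm_triangle_ineq4[of "blinfun_apply (T i) (z + y)" "blinfun_apply (T i) z"]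
        by (simp add: blinfun.add_right)
    qed
    show "norm (T i) \<le> 2 * real n / r"
    proof (rule norm_blinfun_bound)
      fix y
      show "norm (blinfun_apply (T i) y) \<le> 2 * real n / r * norm y"
      proof (cases "y = 0")
        case False
        have "norm (blinfun_apply (T i) ((r / norm y) *\<^sub>R y)) \<le> 2 * real n"
          using False r by (intro small) simp
        then show ?thesis
          using False r by (simp add: blinfun.scaleR_right field_simps)
      qed simp
    qed (use r in simp)
  qed
qed

section \<open>Strongly continuous semigroups and the sun dual\<close>

text \<open>This turns right continuity of an orbit at \<open>0\<close> into two-sided continuity everywhere, for the orbits of
  the semigroup as well as for the orbits in norm of the adjoint semigroup on the sun dual.\<close>

lemma continuous_on_if_increments_vanish:
  fixes g :: "real \<Rightarrow> 'n::real_normed_vector"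
  assumes inc: "\<And>r h. 0 \<le> r \<Longrightarrow> 0 \<le> h \<Longrightarrow> norm (g (r + h) - g r) \<le> B r * e h"
    and B: "\<And>L. \<exists>M. \<forall>r\<in>{0..L}. B r \<le> M"
    and e: "(e \<longlongrightarrow> 0) (at_right 0)" and e0: "\<And>h. 0 \<le> e h"
  shows "continuous_on {0..} g"
  unfolding continuous_on_iff
proof (intro ballI allI impI)
  fix t \<epsilon> :: real assume "t \<in> {0..}" "0 < \<epsilon>"
  obtain M where M: "\<forall>r\<in>{0..t}. B r \<le> M"
    using B by blast
  define M' where "M' = max 1 M"
  have "\<epsilon> / M' > 0" using \<open>0 < \<epsilon>\<close> by (simp add: M'_def)
  then obtain d where d: "d > 0" "\<And>h. 0 < h \<Longrightarrow> h < d \<Longrightarrow> e h < \<epsilon> / M'"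
    using order_tendstoD(2)[OF e, of "\<epsilon> / M'"] by (auto simp: eventually_at_right_field)
  have "dist (g u) (g t) < \<epsilon>" if u: "u \<in> {0..}" "dist u t < d" for u
  proof (cases "u = t")
    case False
    \<comment> \<open>Starting at the smaller of the two times, left continuity needs no separate argument.\<close>
    define r h where "r = min u t" and "h = \<bar>u - t\<bar>"
    have h: "0 < h" "h < d" using u False by (auto simp: h_def dist_real_def)
    have r: "0 \<le> r" "r \<le> t" using u \<open>t \<in> {0..}\<close> by (auto simp: r_def)
    have "dist (g u) (g t) = norm (g (r + h) - g r)"
      by (cases "u \<le> t") (auto simp: r_def h_def dist_norm norm_minus_commute min_def)
    also have "\<dots> \<le> B r * e h"
      using inc r h by simp
    also have "\<dots> \<le> M' * e h"
      using M r e0[of h] by (intro mult_right_mono) (auto simp: M'_def le_max_iff_disj)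
    also have "\<dots> < \<epsilon>"
      using d(2)[OF h] by (simp add: M'_def field_simps)
    finally show ?thesis .
  qed (use \<open>0 < \<epsilon>\<close> in simp)
  then show "\<exists>d>0. \<forall>u\<in>{0..}. dist u t < d \<longrightarrow> dist (g u) (g t) < \<epsilon>"
    using d(1) by blast
qed

locale semigroup_over = banach_over scaleK
  for scaleK :: "'k::{real_normed_field,euclidean_space} \<Rightarrow> 'a::banach \<Rightarrow> 'a" +
  fixes T :: "real \<Rightarrow> 'a \<Rightarrow>\<^sub>L 'a"
  assumes C0: "C0_semigroup scaleK T"
begin

abbreviation sun :: "('a \<Rightarrow>\<^sub>L 'k) set" where "sun \<equiv> sun_dual scaleK T"

lemma T_0: "T 0 = id_blinfun"
  and T_add: "0 \<le> s \<Longrightarrow> 0 \<le> t \<Longrightarrow> T (s + t) = T s o\<^sub>L T t"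
  and T_at_0: "((\<lambda>t. blinfun_apply (T t) x) \<longlongrightarrow> x) (at_right 0)"
  and T_linear: "0 \<le> t \<Longrightarrow> Vector_Spaces.linear scaleK scaleK (blinfun_apply (T t))"
  using C0 by (auto simp: C0_semigroup_def)

lemma T_scaleK: "0 \<le> t \<Longrightarrow> blinfun_apply (T t) (scaleK c x) = scaleK c (blinfun_apply (T t) x)"
  using T_linear[of t] by (simp add: Vector_Spaces.linear_iff)

text \<open>Otherwise the norms of \<open>T (t n)\<close> would be unbounded along a sequence \<open>t n\<close> tending to \<open>0\<close>, although
  each orbit converges along this sequence; this contradicts uniform boundedness.\<close>

lemma T_bounded_near_0:
  obtains M \<delta> where "\<delta> > 0" "\<And>t. 0 \<le> t \<Longrightarrow> t \<le> \<delta> \<Longrightarrow> norm (T t) \<le> M"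
proof -
  have "\<exists>n::nat. \<forall>t. 0 \<le> t \<and> t \<le> 1 / real (Suc n) \<longrightarrow> norm (T t) \<le> real n"
  proof (rule ccontr)
    assume "\<not> ?thesis"
    then obtain t where t: "\<And>n. 0 \<le> t n" "\<And>n. t n \<le> 1 / real (Suc n)"
        "\<And>n. norm (T (t n)) > real n"
      by (metis not_le)
    have t0: "t \<longlonglongrightarrow> 0"
      by (rule tendsto_sandwich[OF _ _ tendsto_const LIMSEQ_inverse_real_of_nat])
         (use t in \<open>auto simp: inverse_eq_divide\<close>)
    have "bounded (range (\<lambda>n. blinfun_apply (T (t n)) x))" for x
    proof (rule convergent_imp_bounded)
      have "continuous (at 0 within {0..}) (\<lambda>t. blinfun_apply (T t) x)"
        using T_at_0[of x] by (simp add: continuous_within at_within_Ici_at_right T_0)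
      then show "(\<lambda>n. blinfun_apply (T (t n)) x) \<longlonglongrightarrow> blinfun_apply (T 0) x"
        by (rule continuous_within_tendsto_compose') (use t t0 in auto)
    qed
    then obtain M where M: "\<And>n. norm (T (t n)) \<le> M"
      using uniform_boundedness[of "\<lambda>n. T (t n)" UNIV] by auto
    obtain n where "M \<le> real n" using real_arch_simple by blast
    then show False using M[of n] t(3)[of n] by linarith
  qed
  then obtain n :: nat where "\<And>t. 0 \<le> t \<Longrightarrow> t \<le> 1 / real (Suc n) \<Longrightarrow> norm (T t) \<le> real n"
    by blast
  then show thesis by (rule that[rotated]) auto
qed

lemma T_bounded_on: "\<exists>M. \<forall>t\<in>{0..L}. norm (T t) \<le> M"
proof -
  obtain M \<delta> where \<delta>: "\<delta> > 0" and M: "\<And>t. 0 \<le> t \<Longrightarrow> t \<le> \<delta> \<Longrightarrow> norm (T t) \<le> M"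
    by (rule T_bounded_near_0) blast
  have M0: "0 \<le> M"
    using order_trans[OF norm_ge_zero M[of 0]] \<delta> by simp
  have step: "\<exists>N. \<forall>t\<in>{0..real n * \<delta>}. norm (T t) \<le> N" for n
  proof (induction n)
    case 0
    then show ?case by auto
  next
    case (Suc n)
    then obtain N where N: "\<forall>t\<in>{0..real n * \<delta>}. norm (T t) \<le> N" by blast
    have "norm (T t) \<le> max M (N * M)" if t: "0 \<le> t" "t \<le> real (Suc n) * \<delta>" for t
    proof (cases "t \<le> \<delta>")
      case True
      then show ?thesis using M[of t] t by simp
    next
      case False
      have "norm (T t) = norm (T (t - \<delta>) o\<^sub>L T \<delta>)"
        using T_add[of "t - \<delta>" \<delta>] False \<delta> by simp
      also have "\<dots> \<le> norm (T (t - \<delta>)) * norm (T \<delta>)"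
        by (rule norm_blinfun_compose)
      also have "\<dots> \<le> N * M"
        using False t \<delta> bspec[OF N, of "t - \<delta>"] M[of \<delta>] M0
        by (intro mult_mono') (auto simp: algebra_simps)
      finally show ?thesis by simp
    qed
    then show ?case by (intro exI[of _ "max M (N * M)"]) auto
  qed
  obtain n where "L / \<delta> \<le> real n" using real_arch_simple by blast
  then have "L \<le> real n * \<delta>" using \<delta> by (simp add: field_simps)
  moreover obtain N where "\<forall>t\<in>{0..real n * \<delta>}. norm (T t) \<le> N" using step by blast
  ultimately show ?thesis by (intro exI[of _ N]) auto
qed

lemma T_bound:
  obtains M where "0 < M" "\<And>t. 0 \<le> t \<Longrightarrow> t \<le> L \<Longrightarrow> norm (T t) \<le> M"
proof -
  obtain M where "\<forall>t\<in>{0..L}. norm (T t) \<le> M" using T_bounded_on by blast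
  then have "norm (T t) \<le> max 1 M" if "0 \<le> t" "t \<le> L" for t
    using that by (simp add: le_max_iff_disj)
  then show thesis by (rule that[rotated]) (auto simp: less_max_iff_disj)
qed

lemma T_strongly_continuous: "continuous_on {0..} (\<lambda>t. blinfun_apply (T t) x)"
proof (rule continuous_on_if_increments_vanish[where B = "\<lambda>r. norm (T r)"
      and e = "\<lambda>h. norm (blinfun_apply (T h) x - x)"])
  fix r h :: real assume "0 \<le> r" "0 \<le> h"
  then have *: "blinfun_apply (T (r + h)) x - blinfun_apply (T r) x
      = blinfun_apply (T r) (blinfun_apply (T h) x - x)"
    by (simp only: T_add blinfun_apply_blinfun_compose blinfun.diff_right)
  show "norm (blinfun_apply (T (r + h)) x - blinfun_apply (T r) x)
      \<le> norm (T r) * norm (blinfun_apply (T h) x - x)"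
    unfolding * by (rule norm_blinfun)
next
  have "((\<lambda>h. blinfun_apply (T h) x - x) \<longlongrightarrow> 0) (at_right 0)"
    by (rule LIM_zero) (rule T_at_0)
  then show "((\<lambda>h. norm (blinfun_apply (T h) x - x)) \<longlongrightarrow> 0) (at_right 0)"
    by (rule tendsto_norm_zero)
next
  show "\<exists>M. \<forall>r\<in>{0..L}. norm (T r) \<le> M" for L
    by (rule T_bounded_on)
next
  show "0 \<le> norm (blinfun_apply (T h) x - x)" for h
    by (rule norm_ge_zero)
qed

lemma sunI:
  assumes "\<And>x y. blinfun_apply \<phi> (x + y) = blinfun_apply \<phi> x + blinfun_apply \<phi> y"
    and "\<And>c x. blinfun_apply \<phi> (scaleK c x) = c * blinfun_apply \<phi> x"
    and "((\<lambda>t. norm ((\<phi> o\<^sub>L T t) - \<phi>)) \<longlongrightarrow> 0) (at_right 0)"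
  shows "\<phi> \<in> sun"
proof -
  have "Vector_Spaces.linear scaleK (*) (blinfun_apply \<phi>)"
    by unfold_locales (simp_all add: assms(1,2) distrib_left distrib_right)
  then show ?thesis
    using assms(3) by (simp add: sun_dual_def dual_space_def)
qed

lemma dual_scaleK:
  "\<phi> \<in> dual_space scaleK \<Longrightarrow> blinfun_apply \<phi> (scaleK c x) = c * blinfun_apply \<phi> x"
  by (simp add: dual_space_def Vector_Spaces.linear_iff)

lemma sun_in_dual: "\<phi> \<in> sun \<Longrightarrow> \<phi> \<in> dual_space scaleK"
  and sun_at_0: "\<phi> \<in> sun \<Longrightarrow> ((\<lambda>t. norm ((\<phi> o\<^sub>L T t) - \<phi>)) \<longlongrightarrow> 0) (at_right 0)"
  by (auto simp: sun_dual_def)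

lemmas sun_scaleK = dual_scaleK[OF sun_in_dual]

lemma sun_diff:
  assumes "\<phi> \<in> sun" "\<psi> \<in> sun"
  shows "\<phi> - \<psi> \<in> sun"
proof (rule sunI)
  have "norm (((\<phi> - \<psi>) o\<^sub>L T t) - (\<phi> - \<psi>)) \<le> norm ((\<phi> o\<^sub>L T t) - \<phi>) + norm ((\<psi> o\<^sub>L T t) - \<psi>)" for t
  proof -
    have "((\<phi> - \<psi>) o\<^sub>L T t) - (\<phi> - \<psi>) = ((\<phi> o\<^sub>L T t) - \<phi>) - ((\<psi> o\<^sub>L T t) - \<psi>)"
      by (rule blinfun_eqI) (simp add: blinfun.diff_left)
    then show ?thesis by (metis norm_triangle_ineq4)
  qed
  then show "((\<lambda>t. norm (((\<phi> - \<psi>) o\<^sub>L T t) - (\<phi> - \<psi>))) \<longlongrightarrow> 0) (at_right 0)"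
    by (intro tendsto_sandwich[OF _ _ tendsto_const
          tendsto_add_zero[OF sun_at_0[OF assms(1)] sun_at_0[OF assms(2)]]]) auto
qed (simp_all add: blinfun.add_right blinfun.diff_left sun_scaleK assms right_diff_distrib)

lemma adjoint_increment:
  assumes "0 \<le> r" "0 \<le> h"
  shows "norm ((\<phi> o\<^sub>L T (r + h)) - (\<phi> o\<^sub>L T r)) \<le> norm (T r) * norm ((\<phi> o\<^sub>L T h) - \<phi>)"
proof -
  have "(\<phi> o\<^sub>L T (r + h)) - (\<phi> o\<^sub>L T r) = ((\<phi> o\<^sub>L T h) - \<phi>) o\<^sub>L T r"
    using T_add[OF assms(2,1)] by (intro blinfun_eqI) (simp add: blinfun.diff_left add.commute)
  then show ?thesis
    using norm_blinfun_compose[of "(\<phi> o\<^sub>L T h) - \<phi>" "T r"] by (simp add: mult.commute)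
qed

lemma sun_comp:
  assumes \<phi>: "\<phi> \<in> sun" and "0 \<le> t"
  shows "\<phi> o\<^sub>L T t \<in> sun"
proof (rule sunI)
  have "\<forall>\<^sub>F h in at_right 0. norm (((\<phi> o\<^sub>L T t) o\<^sub>L T h) - (\<phi> o\<^sub>L T t))
      \<le> norm (T t) * norm ((\<phi> o\<^sub>L T h) - \<phi>)"
  proof (rule eventually_at_rightI[of 0 1])
    fix h :: real assume "h \<in> {0<..<1}"
    then have "(\<phi> o\<^sub>L T t) o\<^sub>L T h = \<phi> o\<^sub>L T (t + h)"
      using T_add[OF \<open>0 \<le> t\<close>, of h] by (intro blinfun_eqI) simp
    then show "norm (((\<phi> o\<^sub>L T t) o\<^sub>L T h) - (\<phi> o\<^sub>L T t)) \<le> norm (T t) * norm ((\<phi> o\<^sub>L T h) - \<phi>)"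
      using adjoint_increment[of t h \<phi>] \<open>0 \<le> t\<close> \<open>h \<in> {0<..<1}\<close> by simp
  qed simp
  then show "((\<lambda>h. norm (((\<phi> o\<^sub>L T t) o\<^sub>L T h) - (\<phi> o\<^sub>L T t))) \<longlongrightarrow> 0) (at_right 0)"
    by (intro tendsto_sandwich[OF _ _ tendsto_const
          tendsto_mult_right_zero[OF sun_at_0[OF \<phi>], of "norm (T t)"]]) auto
qed (simp_all add: blinfun.add_right T_scaleK sun_scaleK assms)

lemma sun_orbit_continuous:
  assumes "\<phi> \<in> sun"
  shows "continuous_on {0..} (\<lambda>t. \<phi> o\<^sub>L T t)"
  by (rule continuous_on_if_increments_vanish[OF adjoint_increment T_bounded_on sun_at_0[OF assms]])
     auto

text \<open>The weak-star integral over \<open>[0, h]\<close> of the orbit of \<open>\<phi>\<close> under the adjoint semigroup. Dividing by \<open>h\<close>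
  gives the means that approximate \<open>\<phi>\<close> by elements of the sun dual; the estimates below are multiplied
  by \<open>h\<close> instead.\<close>

definition orbit_integral :: "('a \<Rightarrow>\<^sub>L 'k) \<Rightarrow> real \<Rightarrow> 'a \<Rightarrow>\<^sub>L 'k" where
  "orbit_integral \<phi> h = Blinfun (\<lambda>x. integral {0..h} (\<lambda>s. blinfun_apply \<phi> (blinfun_apply (T s) x)))"

lemma orbit_continuous:
  assumes "0 \<le> a"
  shows "continuous_on {a..b} (\<lambda>s. blinfun_apply \<phi> (blinfun_apply (T s) x))"
  using assms
  by (intro continuous_intros continuous_on_subset[OF T_strongly_continuous]) auto

lemma orbit_integral_bound:
  fixes \<phi> :: "'a \<Rightarrow>\<^sub>L 'k"
  assumes "0 \<le> a" "a \<le> b" and M: "\<And>s. 0 \<le> s \<Longrightarrow> s \<le> b \<Longrightarrow> norm (T s) \<le> M"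
  shows "norm (integral {a..b} (\<lambda>s. blinfun_apply \<phi> (blinfun_apply (T s) x)))
      \<le> (norm \<phi> * M * norm x) * (b - a)"
proof (rule integral_bound[OF \<open>a \<le> b\<close> orbit_continuous[OF \<open>0 \<le> a\<close>]])
  fix s assume "s \<in> {a..b}"
  then have s: "norm (T s) \<le> M" using assms by simp
  have "norm (blinfun_apply \<phi> (blinfun_apply (T s) x)) \<le> norm \<phi> * norm (blinfun_apply (T s) x)"
    by (rule norm_blinfun)
  also have "\<dots> \<le> norm \<phi> * (norm (T s) * norm x)"
    by (intro mult_left_mono norm_blinfun) simp
  also have "\<dots> \<le> norm \<phi> * (M * norm x)"
    using s by (intro mult_left_mono mult_right_mono) auto
  finally show "norm (blinfun_apply \<phi> (blinfun_apply (T s) x)) \<le> norm \<phi> * M * norm x"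
    by (simp add: mult.assoc)
qed

lemma orbit_integral_apply:
  assumes "0 \<le> h"
  shows "blinfun_apply (orbit_integral \<phi> h) x
    = integral {0..h} (\<lambda>s. blinfun_apply \<phi> (blinfun_apply (T s) x))"
proof -
  let ?F = "\<lambda>x. integral {0..h} (\<lambda>s. blinfun_apply \<phi> (blinfun_apply (T s) x))"
  obtain M where M: "\<And>s. 0 \<le> s \<Longrightarrow> s \<le> h \<Longrightarrow> norm (T s) \<le> M"
    by (rule T_bound[of h]) blast
  have int: "(\<lambda>s. blinfun_apply \<phi> (blinfun_apply (T s) x)) integrable_on {0..h}" for x
    by (rule integrable_continuous_interval) (simp add: orbit_continuous)
  have "bounded_linear ?F"
  proof (rule bounded_linear_intro)
    show "?F (x + y) = ?F x + ?F y" for x y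
      by (simp add: blinfun.add_right integral_add int)
    show "?F (r *\<^sub>R x) = r *\<^sub>R ?F x" for r x
      by (simp add: blinfun.scaleR_right)
    show "norm (?F x) \<le> norm x * (norm \<phi> * M * h)" for x
      using orbit_integral_bound[OF order_refl assms M] by (simp add: mult_ac)
  qed
  then show ?thesis
    by (simp add: orbit_integral_def bounded_linear_Blinfun_apply)
qed

text \<open>Shifting the orbit by \<open>r\<close> changes the integral over \<open>[0, h]\<close> by the integral over \<open>[h, h + r]\<close> minus
  the integral over \<open>[0, r]\<close>, and both are of order \<open>r\<close>.\<close>

lemma orbit_integral_in_sun:
  assumes \<phi>: "\<phi> \<in> dual_space scaleK" and "0 \<le> h"
  shows "orbit_integral \<phi> h \<in> sun"
proof (rule sunI)
  let ?\<phi> = "orbit_integral \<phi> h"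
  fix c x
  let ?f = "\<lambda>s. blinfun_apply \<phi> (blinfun_apply (T s) x)"
  have "integral {0..h} ((*) c \<circ> ?f) = c * integral {0..h} ?f"
    using \<open>0 \<le> h\<close>
    by (intro integral_linear integrable_continuous_interval orbit_continuous
        bounded_linear_mult_right) simp
  moreover have "integral {0..h} (\<lambda>s. blinfun_apply \<phi> (blinfun_apply (T s) (scaleK c x)))
      = integral {0..h} ((*) c \<circ> ?f)"
    by (rule integral_cong) (simp add: T_scaleK dual_scaleK[OF \<phi>])
  ultimately show "blinfun_apply ?\<phi> (scaleK c x) = c * blinfun_apply ?\<phi> x"
    using \<open>0 \<le> h\<close> by (simp add: orbit_integral_apply)
next
  let ?\<phi> = "orbit_integral \<phi> h"
  obtain M where "M > 0" and M: "\<And>s. 0 \<le> s \<Longrightarrow> s \<le> h + 1 \<Longrightarrow> norm (T s) \<le> M"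
    by (rule T_bound[of "h + 1"]) blast
  have bound: "norm ((?\<phi> o\<^sub>L T r) - ?\<phi>) \<le> 2 * norm \<phi> * M * r" if r: "0 \<le> r" "r \<le> 1" for r
  proof (rule norm_blinfun_bound)
    fix x
    let ?f = "\<lambda>s. blinfun_apply \<phi> (blinfun_apply (T s) x)"
    have int: "?f integrable_on {0..h + r}"
      by (intro integrable_continuous_interval orbit_continuous) simp
    have "blinfun_apply (?\<phi> o\<^sub>L T r) x
        = integral {0..h} (\<lambda>s. blinfun_apply \<phi> (blinfun_apply (T s) (blinfun_apply (T r) x)))"
      using \<open>0 \<le> h\<close> by (simp add: orbit_integral_apply)
    also have "\<dots> = integral {0..h} (?f \<circ> (\<lambda>s. s + r))"
      using r by (intro integral_cong) (simp add: T_add)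
    also have "\<dots> = integral {0 + r..h + r} ?f"
      using r by (intro integral_shift orbit_continuous) simp
    finally have "blinfun_apply ((?\<phi> o\<^sub>L T r) - ?\<phi>) x = integral {r..h + r} ?f - integral {0..h} ?f"
      using \<open>0 \<le> h\<close> by (simp add: blinfun.diff_left orbit_integral_apply)
    also have "\<dots> = integral {h..h + r} ?f - integral {0..r} ?f"
      using Henstock_Kurzweil_Integration.integral_combine[of 0 r "h + r" ?f] Henstock_Kurzweil_Integration.integral_combine[of 0 h "h + r" ?f] int r \<open>0 \<le> h\<close>
      by (simp add: algebra_simps)
    also have "norm \<dots> \<le> norm (integral {h..h + r} ?f) + norm (integral {0..r} ?f)"
      by (rule norm_triangle_ineq4)
    also have "\<dots> \<le> (norm \<phi> * M * norm x) * (h + r - h) + (norm \<phi> * M * norm x) * (r - 0)"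
      using r \<open>0 \<le> h\<close> M by (intro add_mono orbit_integral_bound) auto
    finally show "norm (blinfun_apply ((?\<phi> o\<^sub>L T r) - ?\<phi>) x) \<le> 2 * norm \<phi> * M * r * norm x"
      by (simp add: algebra_simps)
  qed (use r \<open>M > 0\<close> in simp)
  have lim: "((\<lambda>r. 2 * norm \<phi> * M * r) \<longlongrightarrow> 0) (at_right 0)"
    by (intro tendsto_mult_right_zero tendsto_ident_at)
  show "((\<lambda>r. norm ((?\<phi> o\<^sub>L T r) - ?\<phi>)) \<longlongrightarrow> 0) (at_right 0)"
  proof (rule tendsto_sandwich[OF _ _ tendsto_const lim])
    show "\<forall>\<^sub>F r in at_right 0. norm ((?\<phi> o\<^sub>L T r) - ?\<phi>) \<le> 2 * norm \<phi> * M * r"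
      by (rule eventually_at_rightI[of 0 1]) (use bound in auto)
  qed simp
qed (simp add: blinfun.add_right)

text \<open>This is where the norm of \<open>x\<close> is controlled by the norm of \<open>jx\<close>: a norming functional \<open>\<phi>\<close> is replaced
  by its mean over \<open>[0, h]\<close>, whose value at \<open>x\<close> tends to that of \<open>\<phi>\<close>, and whose norm is at most \<open>M\<close>.\<close>

theorem sun_norming:
  obtains M where "0 < M"
    "\<And>x c. 0 \<le> c \<Longrightarrow> (\<And>\<phi>. \<phi> \<in> sun \<Longrightarrow> norm (blinfun_apply \<phi> x) \<le> c * norm \<phi>) \<Longrightarrow> norm x \<le> M * c"
proof -
  obtain M where "0 < M" and M: "\<And>t. 0 \<le> t \<Longrightarrow> t \<le> 1 \<Longrightarrow> norm (T t) \<le> M"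
    by (rule T_bound[of 1]) blast
  have "norm x \<le> M * c"
    if "0 \<le> c" and c: "\<And>\<phi>. \<phi> \<in> sun \<Longrightarrow> norm (blinfun_apply \<phi> x) \<le> c * norm \<phi>" for x c
  proof (rule field_le_epsilon)
    fix \<epsilon> :: real assume "0 < \<epsilon>"
    obtain \<phi> where \<phi>: "\<phi> \<in> dual_space scaleK" "norm \<phi> \<le> 1" "norm x \<le> norm (blinfun_apply \<phi> x)"
      by (rule dual_norming)
    let ?f = "\<lambda>s. blinfun_apply \<phi> (blinfun_apply (T s) x)"
    have "continuous_on {0..1} ?f" by (simp add: orbit_continuous)
    then obtain d where d: "d > 0" "\<And>s. 0 \<le> s \<Longrightarrow> s \<le> 1 \<Longrightarrow> s < d \<Longrightarrow> norm (?f s - ?f 0) < \<epsilon>"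
      using \<open>0 < \<epsilon>\<close> unfolding continuous_on_iff by (force simp: dist_norm)
    define h where "h = min 1 (d / 2)"
    have h: "0 < h" "h \<le> 1" "h < d" using d(1) by (auto simp: h_def)
    have "norm (integral {0..h} (\<lambda>s. ?f s - ?f 0)) \<le> \<epsilon> * (h - 0)"
      using h d(2) by (intro integral_bound continuous_intros orbit_continuous)
        (auto intro: less_imp_le)
    moreover have "integral {0..h} (\<lambda>s. ?f s - ?f 0)
        = blinfun_apply (orbit_integral \<phi> h) x - h *\<^sub>R blinfun_apply \<phi> x"
      using h by (subst integral_diff)
        (auto intro!: integrable_continuous_interval orbit_continuous
          simp: orbit_integral_apply T_0)
    ultimately have "norm (blinfun_apply (orbit_integral \<phi> h) x - h *\<^sub>R blinfun_apply \<phi> x) \<le> \<epsilon> * h"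
      by simp
    then have "norm (h *\<^sub>R blinfun_apply \<phi> x) \<le> norm (blinfun_apply (orbit_integral \<phi> h) x) + \<epsilon> * h"
      using norm_triangle_ineq2[of "h *\<^sub>R blinfun_apply \<phi> x" "blinfun_apply (orbit_integral \<phi> h) x"]
      by (simp add: norm_minus_commute)
    also have "norm (blinfun_apply (orbit_integral \<phi> h) x) \<le> c * norm (orbit_integral \<phi> h)"
      using h \<phi> by (intro c orbit_integral_in_sun) auto
    also have "norm (orbit_integral \<phi> h) \<le> M * h"
    proof (rule norm_blinfun_bound)
      fix y
      have "norm (blinfun_apply (orbit_integral \<phi> h) y) \<le> (norm \<phi> * M * norm y) * (h - 0)"
        using h M by (simp add: orbit_integral_apply) (use orbit_integral_bound[of 0 h M \<phi> y] in simp)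
      also have "\<dots> \<le> (1 * M * norm y) * (h - 0)"
        using h \<phi>(2) \<open>0 < M\<close> by (intro mult_right_mono) auto
      finally show "norm (blinfun_apply (orbit_integral \<phi> h) y) \<le> M * h * norm y"
        by (simp add: mult_ac)
    qed (use h \<open>0 < M\<close> in simp)
    finally have "h * norm (blinfun_apply \<phi> x) \<le> c * (M * h) + \<epsilon> * h"
      using h \<open>0 \<le> c\<close> by (simp add: mult_left_mono)
    then have "h * norm (blinfun_apply \<phi> x) \<le> h * (M * c + \<epsilon>)"
      by (simp add: algebra_simps)
    then show "norm x \<le> M * c + \<epsilon>"
      using h \<phi>(3) by simp
  qed
  with \<open>0 < M\<close> show thesis by (rule that)
qed

section \<open>Continuous forcing functions\<close>

abbreviation sun_star_space :: "(('a \<Rightarrow>\<^sub>L 'k) \<Rightarrow> 'k) set" where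
  "sun_star_space \<equiv> sun_star scaleK T"

lemma Metric_space_sun_star_space: "Metric_space sun_star_space (sun_star_dist scaleK T)"
  by (rule Metric_space_sun_star) (rule banach_over_axioms)

lemma topspace_sun_star: "topspace (sun_star_topology scaleK T) = sun_star_space"
  by (simp add: sun_star_topology_def Metric_space.topspace_mtopology[OF Metric_space_sun_star_space])

lemma sun_star_diff:
  assumes q: "q \<in> sun_star_space" and "\<phi> \<in> sun" "\<psi> \<in> sun"
  shows "q (\<phi> - \<psi>) = q \<phi> - q \<psi>"
proof -
  have "q ((\<phi> - \<psi>) + \<psi>) = q (\<phi> - \<psi>) + q \<psi>"
    using q sun_diff[OF assms(2,3)] assms(3) unfolding sun_star_def by blast
  then show ?thesis by simp
qed

lemma sun_star_bounded:
  assumes "q \<in> sun_star_space"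
  shows "\<exists>B\<ge>0. \<forall>\<phi>\<in>sun. norm (q \<phi>) \<le> B * norm \<phi>"
proof -
  obtain B where B: "\<forall>\<phi>\<in>sun. norm (q \<phi>) \<le> B * norm \<phi>"
    using assms by (auto simp: sun_star_def)
  have "norm (q \<phi>) \<le> \<bar>B\<bar> * norm \<phi>" if "\<phi> \<in> sun" for \<phi>
    using order_trans[OF bspec[OF B that] mult_right_mono[OF abs_ge_self norm_ge_zero]] .
  then show ?thesis by (intro exI[of _ "\<bar>B\<bar>"]) simp
qed

lemma sun_star_dist_bound:
  assumes p: "p \<in> sun_star_space" and q: "q \<in> sun_star_space" and \<phi>: "\<phi> \<in> sun"
  shows "norm (p \<phi> - q \<phi>) \<le> sun_star_dist scaleK T p q * norm \<phi>"
proof (cases "\<phi> = 0")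
  case True
  have "r 0 = 0" if "r \<in> sun_star_space" for r
    using sun_star_bounded[OF that] \<phi> True by force
  from this[OF p] this[OF q] show ?thesis using True by simp
next
  case False
  obtain A where A: "\<forall>\<phi>\<in>sun. norm (p \<phi>) \<le> A * norm \<phi>"
    using sun_star_bounded[OF p] by blast
  obtain B where B: "\<forall>\<phi>\<in>sun. norm (q \<phi>) \<le> B * norm \<phi>"
    using sun_star_bounded[OF q] by blast
  have bdd: "bdd_above ((\<lambda>\<phi>. norm (p \<phi> - q \<phi>) / norm \<phi>) ` sun)"
  proof (rule bdd_aboveI2)
    fix \<psi> assume \<psi>: "\<psi> \<in> sun"
    show "norm (p \<psi> - q \<psi>) / norm \<psi> \<le> \<bar>A + B\<bar>"
    proof (cases "\<psi> = 0")
      case False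
      have "norm (p \<psi> - q \<psi>) \<le> (A + B) * norm \<psi>"
        using bspec[OF A \<psi>] bspec[OF B \<psi>] norm_triangle_ineq4[of "p \<psi>" "q \<psi>"]
        by (simp add: distrib_right)
      then have "norm (p \<psi> - q \<psi>) / norm \<psi> \<le> A + B"
        using False by (simp add: divide_le_eq)
      then show ?thesis by linarith
    qed simp
  qed
  have "norm (p \<phi> - q \<phi>) / norm \<phi> \<le> sun_star_dist scaleK T p q"
    using cSUP_upper[OF \<phi> bdd] p q by (simp add: sun_star_dist_def sun_star_norm_def)
  then show ?thesis
    using False by (simp add: divide_le_eq)
qed

lemma continuous_forcingD:
  fixes \<tau> :: real
  assumes f: "continuous_map (top_of_set J) (sun_star_topology scaleK T) f"
    and \<tau>: "\<tau> \<in> J" and "0 < \<epsilon>"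
  obtains d where "0 < d" "\<And>\<sigma> \<phi>. \<sigma> \<in> J \<Longrightarrow> \<bar>\<sigma> - \<tau>\<bar> < d \<Longrightarrow> \<phi> \<in> sun \<Longrightarrow>
      norm (f \<sigma> \<phi> - f \<tau> \<phi>) \<le> \<epsilon> * norm \<phi>"
proof -
  interpret Metric_space sun_star_space "sun_star_dist scaleK T"
    by (rule Metric_space_sun_star_space)
  obtain U where U: "openin (top_of_set J) U" "\<tau> \<in> U" "\<forall>\<sigma>\<in>U. f \<sigma> \<in> mball (f \<tau>) \<epsilon>"
    using f \<tau> \<open>0 < \<epsilon>\<close> unfolding sun_star_topology_def continuous_map_to_metric
    by (simp del: in_mball) blast
  obtain d where d: "d > 0" "ball \<tau> d \<inter> J \<subseteq> U"
    using U(1,2) by (auto simp: openin_contains_ball)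
  show thesis
  proof
    fix \<sigma> \<phi> assume "\<sigma> \<in> J" "\<bar>\<sigma> - \<tau>\<bar> < d" and \<phi>: "\<phi> \<in> sun"
    then have "f \<sigma> \<in> mball (f \<tau>) \<epsilon>"
      using d(2) U(3) by (auto simp: dist_real_def abs_minus_commute subset_iff)
    then have *: "f \<sigma> \<in> sun_star_space" "f \<tau> \<in> sun_star_space"
        "sun_star_dist scaleK T (f \<sigma>) (f \<tau>) \<le> \<epsilon>"
      by (auto simp: commute)
    show "norm (f \<sigma> \<phi> - f \<tau> \<phi>) \<le> \<epsilon> * norm \<phi>"
      using sun_star_dist_bound[OF *(1,2) \<phi>] mult_right_mono[OF *(3), of "norm \<phi>"] by simp
  qed (rule d(1))
qed

lemma norm_adjoint_le:
  assumes "norm (T r) \<le> M"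
  shows "norm (\<phi> o\<^sub>L T r) \<le> M * norm \<phi>"
  using order_trans[OF norm_blinfun_compose[of \<phi> "T r"] mult_left_mono[OF assms norm_ge_zero[of \<phi>]]]
  by (simp add: mult.commute)

text \<open>Both factors move with \<open>\<tau>\<close>: the functional \<open>f \<tau>\<close> is continuous in norm, and so is its argument because
  \<open>\<phi>\<close> belongs to the sun dual. In particular the weak-star integrals are integrals of continuous
  functions.\<close>

lemma integrand_continuous:
  assumes f: "continuous_map (top_of_set J) (sun_star_topology scaleK T) f"
    and st: "{s..t} \<subseteq> J" and \<phi>: "\<phi> \<in> sun"
  shows "continuous_on {s..t} (\<lambda>\<tau>. f \<tau> (\<phi> o\<^sub>L T (t - \<tau>)))"
  unfolding continuous_on_iff
proof (intro ballI allI impI)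
  fix \<tau> \<epsilon> :: real assume \<tau>: "\<tau> \<in> {s..t}" and "0 < \<epsilon>"
  let ?\<psi> = "\<lambda>\<tau>. \<phi> o\<^sub>L T (t - \<tau>)"
  have f\<tau>: "f \<tau> \<in> sun_star_space"
    using f \<tau> st by (auto simp: continuous_map_def topspace_sun_star Pi_iff)
  have \<psi>: "?\<psi> \<sigma> \<in> sun" if "\<sigma> \<in> {s..t}" for \<sigma>
    using that by (intro sun_comp[OF \<phi>]) simp
  obtain M where "M > 0" and M: "\<And>r. 0 \<le> r \<Longrightarrow> r \<le> t - s \<Longrightarrow> norm (T r) \<le> M"
    by (rule T_bound[of "t - s"]) blast
  obtain B where "B \<ge> 0" and B: "\<forall>\<psi>\<in>sun. norm (f \<tau> \<psi>) \<le> B * norm \<psi>"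
    using sun_star_bounded[OF f\<tau>] by blast
  define \<eta> where "\<eta> = \<epsilon> / 3 / (M * (norm \<phi> + 1))"
  have "\<eta> > 0" using \<open>0 < \<epsilon>\<close> \<open>M > 0\<close> by (simp add: \<eta>_def add_nonneg_pos)
  then obtain d1 where d1: "0 < d1" "\<And>\<sigma> \<psi>. \<sigma> \<in> J \<Longrightarrow> \<bar>\<sigma> - \<tau>\<bar> < d1 \<Longrightarrow> \<psi> \<in> sun \<Longrightarrow>
      norm (f \<sigma> \<psi> - f \<tau> \<psi>) \<le> \<eta> * norm \<psi>"
    using continuous_forcingD[OF f, of \<tau> \<eta>] \<tau> st by blast
  have "continuous_on {s..t} ?\<psi>"
    by (rule continuous_on_compose2[OF sun_orbit_continuous[OF \<phi>]]) (auto intro!: continuous_intros)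
  moreover have "\<epsilon> / 3 / (B + 1) > 0" using \<open>0 < \<epsilon>\<close> \<open>B \<ge> 0\<close> by simp
  ultimately obtain d2 where d2: "0 < d2" "\<And>\<sigma>. \<sigma> \<in> {s..t} \<Longrightarrow> dist \<sigma> \<tau> < d2 \<Longrightarrow>
      dist (?\<psi> \<sigma>) (?\<psi> \<tau>) < \<epsilon> / 3 / (B + 1)"
    using \<tau> unfolding continuous_on_iff by meson
  have "dist (f \<sigma> (?\<psi> \<sigma>)) (f \<tau> (?\<psi> \<tau>)) < \<epsilon>" if \<sigma>: "\<sigma> \<in> {s..t}" "dist \<sigma> \<tau> < min d1 d2" for \<sigma>
  proof -
    have "norm (f \<sigma> (?\<psi> \<sigma>) - f \<tau> (?\<psi> \<sigma>)) \<le> \<eta> * norm (?\<psi> \<sigma>)"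
      using \<sigma> st by (intro d1(2) \<psi>) (auto simp: dist_real_def)
    also have "\<dots> \<le> \<eta> * (M * norm \<phi>)"
      using \<sigma> \<open>\<eta> > 0\<close> by (intro mult_left_mono norm_adjoint_le M) auto
    also have "\<dots> \<le> \<eta> * (M * (norm \<phi> + 1))"
      using \<open>\<eta> > 0\<close> \<open>M > 0\<close> by (intro mult_left_mono) auto
    also have "\<dots> = \<epsilon> / 3"
      using \<open>M > 0\<close> norm_ge_zero[of \<phi>] unfolding \<eta>_def by (simp add: add_nonneg_eq_0_iff)
    finally have 1: "norm (f \<sigma> (?\<psi> \<sigma>) - f \<tau> (?\<psi> \<sigma>)) \<le> \<epsilon> / 3" .
    have "norm (f \<tau> (?\<psi> \<sigma>) - f \<tau> (?\<psi> \<tau>)) = norm (f \<tau> (?\<psi> \<sigma> - ?\<psi> \<tau>))"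
      using sun_star_diff[OF f\<tau> \<psi>[OF \<sigma>(1)] \<psi>[OF \<tau>]] by simp
    also have "\<dots> \<le> B * norm (?\<psi> \<sigma> - ?\<psi> \<tau>)"
      using B sun_diff[OF \<psi>[OF \<sigma>(1)] \<psi>[OF \<tau>]] by blast
    also have "\<dots> \<le> (B + 1) * (\<epsilon> / 3 / (B + 1))"
      using d2(2)[OF \<sigma>(1)] \<sigma>(2) \<open>B \<ge> 0\<close> by (intro mult_mono) (auto simp: dist_norm)
    also have "\<dots> = \<epsilon> / 3" using \<open>B \<ge> 0\<close> by (simp add: nonzero_eq_divide_eq field_simps)
    finally have 2: "norm (f \<tau> (?\<psi> \<sigma>) - f \<tau> (?\<psi> \<tau>)) \<le> \<epsilon> / 3" .
    show ?thesis
      using dist_triangle_le[of "f \<sigma> (?\<psi> \<sigma>)" "f \<tau> (?\<psi> \<sigma>)" "f \<tau> (?\<psi> \<tau>)" "\<epsilon> / 3 + \<epsilon> / 3"] 1 2 \<open>0 < \<epsilon>\<close>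
      by (simp add: dist_norm norm_minus_commute)
  qed
  then show "\<exists>d>0. \<forall>\<sigma>\<in>{s..t}. dist \<sigma> \<tau> < d \<longrightarrow> dist (f \<sigma> (?\<psi> \<sigma>)) (f \<tau> (?\<psi> \<tau>)) < \<epsilon>"
    using d1(1) d2(1) by (intro exI[of _ "min d1 d2"]) auto
qed

text \<open>Functionals are extended by zero off the sun dual on both sides, so that only the values on the sun
  dual have to be compared.\<close>

lemma v0_in_range_iff:
  "v0 scaleK T t s f \<in> range (sun_embed scaleK T) \<longleftrightarrow>
    (\<exists>x. \<forall>\<phi>\<in>sun. integral {s..t} (\<lambda>\<tau>. f \<tau> (\<phi> o\<^sub>L T (t - \<tau>))) = blinfun_apply \<phi> x)"
proof -
  have "v0 scaleK T t s f = sun_embed scaleK T x \<longleftrightarrow>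
      (\<forall>\<phi>\<in>sun. integral {s..t} (\<lambda>\<tau>. f \<tau> (\<phi> o\<^sub>L T (t - \<tau>))) = blinfun_apply \<phi> x)" for x
    by (auto simp: v0_def weak_star_integral_def sun_star_semigroup_def sun_embed_def fun_eq_iff)
  then show ?thesis by (auto simp: image_iff)
qed

section \<open>Convolutions with values in the embedded space\<close>

text \<open>By translation the interval \<open>[u, v]\<close> may be moved into \<open>J\<close>, where the hypothesis provides \<open>x\<close> for the
  convolution up to time \<open>v\<close>. The remaining time \<open>t - v\<close> replaces \<open>x\<close> by its image under \<open>T (t - v)\<close>.\<close>

lemma short_constant_convolution:
  assumes q: "(\<lambda>\<tau>. q) \<in> admissible_forcing scaleK T J"
    and ab: "a \<in> J" "b \<in> J" and J: "is_interval J"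
    and uv: "u \<le> v" "v - u \<le> b - a" and "v \<le> t"
  shows "\<exists>x. \<forall>\<phi>\<in>sun. integral {u..v} (\<lambda>\<tau>. q (\<phi> o\<^sub>L T (t - \<tau>))) = blinfun_apply \<phi> x"
proof -
  let ?c = "a + (v - u)"
  have "?c \<in> J"
    using mem_is_interval_1_I[OF J ab] uv by simp
  then have "v0 scaleK T ?c a (\<lambda>\<tau>. q) \<in> range (sun_embed scaleK T)"
    using q ab(1) uv(1) by (simp add: admissible_forcing_def)
  then obtain x where x: "\<forall>\<phi>\<in>sun. integral {a..?c} (\<lambda>\<tau>. q (\<phi> o\<^sub>L T (?c - \<tau>))) = blinfun_apply \<phi> x"
    unfolding v0_in_range_iff by blast
  have "integral {u..v} (\<lambda>\<tau>. q (\<phi> o\<^sub>L T (t - \<tau>))) = blinfun_apply \<phi> (blinfun_apply (T (t - v)) x)"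
    if \<phi>: "\<phi> \<in> sun" for \<phi>
  proof -
    let ?\<psi> = "\<phi> o\<^sub>L T (t - v)"
    have "\<phi> o\<^sub>L T (t - \<tau>) = ?\<psi> o\<^sub>L T (v - \<tau>)" if "\<tau> \<in> {u..v}" for \<tau>
      using T_add[of "t - v" "v - \<tau>"] that \<open>v \<le> t\<close> by (intro blinfun_eqI) simp
    then have "integral {u..v} (\<lambda>\<tau>. q (\<phi> o\<^sub>L T (t - \<tau>))) = integral {u..v} (\<lambda>\<tau>. q (?\<psi> o\<^sub>L T (v - \<tau>)))"
      by (intro integral_cong arg_cong[of _ _ q])
    also have "\<dots> = integral {a..?c} (\<lambda>\<tau>. q (?\<psi> o\<^sub>L T (?c - \<tau>)))"
      using integral_shift_real_ivl[of a "a - u" ?c "\<lambda>\<tau>. q (?\<psi> o\<^sub>L T (?c - \<tau>))"]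
      by (simp add: algebra_simps)
    also have "\<dots> = blinfun_apply ?\<psi> x"
      using x sun_comp[OF \<phi>, of "t - v"] \<open>v \<le> t\<close> by simp
    finally show ?thesis by simp
  qed
  then show ?thesis by blast
qed

text \<open>The error is proportional to the length of the interval, hence additive under concatenation. It
  therefore suffices to treat short intervals around each point \<open>z\<close>, on which \<open>f\<close> is replaced by the
  constant \<open>f z\<close>.\<close>

lemma convolution_approx:
  assumes f: "continuous_map (top_of_set J) (sun_star_topology scaleK T) f"
    and st: "s \<le> t" "{s..t} \<subseteq> J" and "0 < \<epsilon>"
    and J0: "is_interval J0" "a \<in> J0" "b \<in> J0" "a < b"
    and const: "\<And>\<tau>. \<tau> \<in> J \<Longrightarrow> (\<lambda>_. f \<tau>) \<in> admissible_forcing scaleK T J0"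
  shows "\<exists>x. \<forall>\<phi>\<in>sun. norm (integral {s..t} (\<lambda>\<tau>. f \<tau> (\<phi> o\<^sub>L T (t - \<tau>))) - blinfun_apply \<phi> x)
      \<le> \<epsilon> * (t - s) * norm \<phi>"
proof -
  let ?g = "\<lambda>\<phi> \<tau>. f \<tau> (\<phi> o\<^sub>L T (t - \<tau>))"
  define P where "P u v \<longleftrightarrow> (s \<le> u \<and> v \<le> t \<longrightarrow> (\<exists>x. \<forall>\<phi>\<in>sun.
      norm (integral {u..v} (?g \<phi>) - blinfun_apply \<phi> x) \<le> \<epsilon> * (v - u) * norm \<phi>))" for u v
  obtain M where "M > 0" and M: "\<And>r. 0 \<le> r \<Longrightarrow> r \<le> t - s \<Longrightarrow> norm (T r) \<le> M"
    by (rule T_bound[of "t - s"]) blast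
  have "P s t"
    using \<open>s \<le> t\<close>
  proof (induction rule: Bolzano)
    case (trans u v w)
    show ?case
      unfolding P_def
    proof (intro impI)
      assume uw: "s \<le> u \<and> w \<le> t"
      obtain x where x: "\<forall>\<phi>\<in>sun. norm (integral {u..v} (?g \<phi>) - blinfun_apply \<phi> x) \<le> \<epsilon> * (v - u) * norm \<phi>"
        using trans uw by (auto simp: P_def)
      obtain y where y: "\<forall>\<phi>\<in>sun. norm (integral {v..w} (?g \<phi>) - blinfun_apply \<phi> y) \<le> \<epsilon> * (w - v) * norm \<phi>"
        using trans uw by (auto simp: P_def)
      have "norm (integral {u..w} (?g \<phi>) - blinfun_apply \<phi> (x + y)) \<le> \<epsilon> * (w - u) * norm \<phi>"
        if \<phi>: "\<phi> \<in> sun" for \<phi>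
      proof -
        have "?g \<phi> integrable_on {u..w}"
          using uw by (intro integrable_continuous_interval
              continuous_on_subset[OF integrand_continuous[OF f st(2) \<phi>]]) auto
        then have "integral {u..w} (?g \<phi>) = integral {u..v} (?g \<phi>) + integral {v..w} (?g \<phi>)"
          using trans by (intro Henstock_Kurzweil_Integration.integral_combine[symmetric]) auto
        then have "integral {u..w} (?g \<phi>) - blinfun_apply \<phi> (x + y)
            = (integral {u..v} (?g \<phi>) - blinfun_apply \<phi> x) + (integral {v..w} (?g \<phi>) - blinfun_apply \<phi> y)"
          by (simp add: blinfun.add_right)
        also have "norm \<dots> \<le> \<epsilon> * (v - u) * norm \<phi> + \<epsilon> * (w - v) * norm \<phi>"
          using x y \<phi> by (intro norm_triangle_mono) auto
        finally show ?thesis by (simp add: algebra_simps)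
      qed
      then show "\<exists>x. \<forall>\<phi>\<in>sun. norm (integral {u..w} (?g \<phi>) - blinfun_apply \<phi> x) \<le> \<epsilon> * (w - u) * norm \<phi>"
        by blast
    qed
  next
    case (local z)
    have z: "z \<in> J" using local st by auto
    \<comment> \<open>The factor \<open>M\<close> is lost when \<open>\<phi>\<close> is composed with \<open>T (t - \<tau>)\<close>.\<close>
    have "0 < \<epsilon> / M" using \<open>0 < \<epsilon>\<close> \<open>M > 0\<close> by simp
    then obtain d where d: "0 < d" "\<And>\<sigma> \<phi>. \<sigma> \<in> J \<Longrightarrow> \<bar>\<sigma> - z\<bar> < d \<Longrightarrow> \<phi> \<in> sun \<Longrightarrow>
        norm (f \<sigma> \<phi> - f z \<phi>) \<le> \<epsilon> / M * norm \<phi>"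
      using continuous_forcingD[OF f z, of "\<epsilon> / M"] by blast
    have fz: "continuous_map (top_of_set J) (sun_star_topology scaleK T) (\<lambda>_. f z)"
      using f z by (auto simp: continuous_map_def topspace_sun_star Pi_iff)
    have "P u v" if uv: "u \<le> z" "z \<le> v" "v - u < min d (b - a)" for u v
      unfolding P_def
    proof (intro impI)
      assume uv': "s \<le> u \<and> v \<le> t"
      obtain x where x: "\<forall>\<phi>\<in>sun. integral {u..v} (\<lambda>\<tau>. f z (\<phi> o\<^sub>L T (t - \<tau>))) = blinfun_apply \<phi> x"
        using short_constant_convolution[OF const[OF z] J0(2,3,1), of u v t] uv uv' by auto
      have "norm (integral {u..v} (?g \<phi>) - blinfun_apply \<phi> x) \<le> \<epsilon> * (v - u) * norm \<phi>"
        if \<phi>: "\<phi> \<in> sun" for \<phi>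
      proof -
        let ?h = "\<lambda>\<tau>. f z (\<phi> o\<^sub>L T (t - \<tau>))"
        have cont: "continuous_on {u..v} (?g \<phi>)" "continuous_on {u..v} ?h"
          using uv' by (auto intro!: continuous_on_subset[OF integrand_continuous[OF f st(2) \<phi>]]
              continuous_on_subset[OF integrand_continuous[OF fz st(2) \<phi>]])
        have "integral {u..v} (?g \<phi>) - blinfun_apply \<phi> x = integral {u..v} (?g \<phi>) - integral {u..v} ?h"
          using x \<phi> by simp
        also have "\<dots> = integral {u..v} (\<lambda>\<tau>. ?g \<phi> \<tau> - ?h \<tau>)"
          by (intro integral_diff[symmetric] integrable_continuous_interval cont)
        also have "norm \<dots> \<le> (\<epsilon> * norm \<phi>) * (v - u)"
        proof (rule integral_bound)
          fix \<tau> assume \<tau>: "\<tau> \<in> {u..v}"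
          have "norm (?g \<phi> \<tau> - ?h \<tau>) \<le> \<epsilon> / M * norm (\<phi> o\<^sub>L T (t - \<tau>))"
            using \<tau> uv uv' st by (intro d(2) sun_comp[OF \<phi>]) auto
          also have "\<dots> \<le> \<epsilon> / M * (M * norm \<phi>)"
            using \<tau> uv' \<open>0 < \<epsilon> / M\<close> by (intro mult_left_mono norm_adjoint_le M) auto
          finally show "norm (?g \<phi> \<tau> - ?h \<tau>) \<le> \<epsilon> * norm \<phi>"
            using \<open>M > 0\<close> by simp
        qed (use uv cont in \<open>auto intro: continuous_on_diff\<close>)
        finally show ?thesis by (simp add: mult_ac)
      qed
      then show "\<exists>x. \<forall>\<phi>\<in>sun. norm (integral {u..v} (?g \<phi>) - blinfun_apply \<phi> x) \<le> \<epsilon> * (v - u) * norm \<phi>"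
        by blast
    qed
    then show ?case
      using d(1) J0(4) by (intro exI[of _ "min d (b - a)"]) auto
  qed
  then show ?thesis by (simp add: P_def)
qed

text \<open>Norm closedness of \<open>jX\<close>. Approximating elements form a Cauchy sequence since the sun dual is norming
  up to a constant.\<close>

lemma functional_approximable_imp_embedded:
  fixes F :: "('a \<Rightarrow>\<^sub>L 'k) \<Rightarrow> 'k"
  assumes approx: "\<And>\<epsilon>. 0 < \<epsilon> \<Longrightarrow> \<exists>x. \<forall>\<phi>\<in>sun. norm (F \<phi> - blinfun_apply \<phi> x) \<le> \<epsilon> * norm \<phi>"
  shows "\<exists>x. \<forall>\<phi>\<in>sun. F \<phi> = blinfun_apply \<phi> x"
proof -
  define e where "e n = inverse (real (Suc n))" for n
  have e: "e n > 0" for n by (simp add: e_def)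
  have e0: "e \<longlonglongrightarrow> 0" unfolding e_def by (rule LIMSEQ_inverse_real_of_nat)
  have "\<forall>n. \<exists>x. \<forall>\<phi>\<in>sun. norm (F \<phi> - blinfun_apply \<phi> x) \<le> e n * norm \<phi>"
    using approx e by blast
  then obtain x where x: "\<And>n \<phi>. \<phi> \<in> sun \<Longrightarrow> norm (F \<phi> - blinfun_apply \<phi> (x n)) \<le> e n * norm \<phi>"
    by metis
  obtain M where "M > 0" and M: "\<And>x c. 0 \<le> c \<Longrightarrow>
      (\<And>\<phi>. \<phi> \<in> sun \<Longrightarrow> norm (blinfun_apply \<phi> x) \<le> c * norm \<phi>) \<Longrightarrow> norm x \<le> M * c"
    by (rule sun_norming) blast
  have diff: "norm (x m - x n) \<le> M * (e m + e n)" for m n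
  proof (rule M)
    fix \<phi> assume \<phi>: "\<phi> \<in> sun"
    have "blinfun_apply \<phi> (x m - x n) = (F \<phi> - blinfun_apply \<phi> (x n)) - (F \<phi> - blinfun_apply \<phi> (x m))"
      by (simp add: blinfun.diff_right)
    also have "norm \<dots> \<le> e n * norm \<phi> + e m * norm \<phi>"
      by (rule order_trans[OF norm_triangle_ineq4 add_mono[OF x[OF \<phi>] x[OF \<phi>]]])
    finally show "norm (blinfun_apply \<phi> (x m - x n)) \<le> (e m + e n) * norm \<phi>"
      by (simp add: algebra_simps)
  qed (simp add: e less_imp_le)
  have "Cauchy x"
  proof (rule metric_CauchyI)
    fix r :: real assume "0 < r"
    then have "0 < r / (2 * M)" using \<open>M > 0\<close> by simp
    then obtain N where N: "\<forall>n\<ge>N. e n < r / (2 * M)"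
      using order_tendstoD(2)[OF e0] unfolding eventually_sequentially by blast
    have "dist (x m) (x n) < r" if "m \<ge> N" "n \<ge> N" for m n
    proof -
      have "M * (e m + e n) < M * (r / (2 * M) + r / (2 * M))"
        using N that \<open>M > 0\<close> by (intro mult_strict_left_mono add_strict_mono) auto
      also have "\<dots> = r" using \<open>M > 0\<close> by (simp add: field_simps)
      finally show ?thesis using diff[of m n] by (simp add: dist_norm)
    qed
    then show "\<exists>N. \<forall>m\<ge>N. \<forall>n\<ge>N. dist (x m) (x n) < r" by blast
  qed
  then obtain y where y: "x \<longlonglongrightarrow> y"
    using Cauchy_convergent_iff convergent_def by blast
  have "F \<phi> = blinfun_apply \<phi> y" if \<phi>: "\<phi> \<in> sun" for \<phi>
  proof -
    have "(\<lambda>n. e n * norm \<phi>) \<longlonglongrightarrow> 0"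
      using tendsto_mult_left_zero[OF e0] .
    then have "(\<lambda>n. F \<phi> - blinfun_apply \<phi> (x n)) \<longlonglongrightarrow> 0"
      by (rule Lim_null_comparison[rotated]) (simp add: x \<phi>)
    moreover have "(\<lambda>n. F \<phi> - blinfun_apply \<phi> (x n)) \<longlonglongrightarrow> F \<phi> - blinfun_apply \<phi> y"
      by (intro tendsto_intros y)
    ultimately have "F \<phi> - blinfun_apply \<phi> y = 0"
      using LIMSEQ_unique by blast
    then show ?thesis by simp
  qed
  then show ?thesis by blast
qed

end

theorem theorem7:
  fixes scaleK :: "'k::{real_normed_field,euclidean_space} \<Rightarrow> 'a::banach \<Rightarrow> 'a"
    and T0 :: "real \<Rightarrow> 'a \<Rightarrow>\<^sub>L 'a"
    and X0 :: "(('a \<Rightarrow>\<^sub>L 'k) \<Rightarrow> 'k) set"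
  assumes "banach_over scaleK"
    and "C0_semigroup scaleK T0"
    and "closed_subspace scaleK T0 X0"
    and "\<exists>J. nondegenerate_interval J \<and>
           (\<forall>q\<in>X0. (\<lambda>\<tau>. q) \<in> admissible_forcing scaleK T0 J)"
  shows "admissible_range scaleK T0 X0"
proof -
  interpret semigroup_over scaleK T0
    using assms(1,2) by (simp add: semigroup_over_def semigroup_over_axioms_def)
  obtain J0 a b where J0: "is_interval J0" "a \<in> J0" "b \<in> J0" "a < b"
    and const: "\<And>q. q \<in> X0 \<Longrightarrow> (\<lambda>\<tau>. q) \<in> admissible_forcing scaleK T0 J0"
    using assms(4) unfolding nondegenerate_interval_def by blast
  have "v0 scaleK T0 t s f \<in> range (sun_embed scaleK T0)"
    if J: "is_interval J" and f: "continuous_map (top_of_set J) (sun_star_topology scaleK T0) f"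
      and fX0: "f ` J \<subseteq> X0" and ts: "t \<in> J" "s \<in> J" "s \<le> t" for J f t s
    unfolding v0_in_range_iff
  proof (rule functional_approximable_imp_embedded)
    fix \<epsilon> :: real assume "0 < \<epsilon>"
    let ?F = "\<lambda>\<phi>. integral {s..t} (\<lambda>\<tau>. f \<tau> (\<phi> o\<^sub>L T0 (t - \<tau>)))"
    \<comment> \<open>The summand \<open>1\<close> keeps the denominator positive when \<open>s = t\<close>.\<close>
    let ?\<delta> = "\<epsilon> / (t - s + 1)"
    have "{s..t} \<subseteq> J"
      using mem_is_interval_1_I[OF J ts(2,1)] by auto
    moreover have "0 < ?\<delta>" using \<open>0 < \<epsilon>\<close> ts(3) by simp
    ultimately obtain x where x: "\<forall>\<phi>\<in>sun. norm (?F \<phi> - blinfun_apply \<phi> x) \<le> ?\<delta> * (t - s) * norm \<phi>"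
      using convolution_approx[OF f ts(3) _ _ J0 const] fX0 by blast
    have "?\<delta> * (t - s) \<le> \<epsilon>"
      using \<open>0 < \<epsilon>\<close> ts(3) by (simp add: field_simps)
    then have "?\<delta> * (t - s) * norm \<phi> \<le> \<epsilon> * norm \<phi>" for \<phi> :: "'a \<Rightarrow>\<^sub>L 'k"
      by (rule mult_right_mono) simp
    then show "\<exists>x. \<forall>\<phi>\<in>sun. norm (?F \<phi> - blinfun_apply \<phi> x) \<le> \<epsilon> * norm \<phi>"
      using x by (meson order_trans)
  qed
  then show ?thesis
    using assms(3)
    by (auto simp: admissible_range_def admissible_forcing_def nondegenerate_interval_def)
qed

end
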